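(* Fix $c>3/2$. Almost surely, \[ |\{n\in\mathcal R: n\le x\}| = \int_2^x\frac{dt}{\log t} + O\big(x^{1/2}(\log x)^c\big)\qquad (x\to\infty), \] where the implied constant may depend on $c$ and on the outcome of the random choices.
   Context: Random model: for each prime $p$ choose a residue class $a_p \bmod p$ uniformly at random, jointly independently over $p$. For $z\ge2$ let $\mathcal S_z\defeq\mathbb Z\setminus\bigcup_{p\le z}\{n:n\equiv a_p\bmod p\}$, $\Theta_z\defeq\prod_{p\le z}(1-1/p)$, and for $t\ge e^2$ let $z(t)$ be the largest prime $z$ with $\Theta_z^{-1}\le\log t$. Put $\mathcal R\defeq\{n\in\mathbb N:n\ge e^2,\ n\in\mathcal S_{z(n)}\}$. *)

theory Defs
  imports "HOL-Probability.Probability" "HOL-Number_Theory.Number_Theory"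
    "HOL-Library.Landau_Symbols"
begin

text \<open>
  A choice of residue classes is a function \<open>a\<close> from primes to integers, where \<open>a p\<close> represents
  the class \<open>a p\<close> modulo \<open>p\<close>; the values of \<open>a\<close> at non-primes are irrelevant.
\<close>

definition sifted :: "(nat \<Rightarrow> int) \<Rightarrow> real \<Rightarrow> int set" where
  "sifted a z = UNIV - (\<Union>p\<in>{p. prime p \<and> real p \<le> z}. {n. [n = a p] (mod int p)})"

definition \<Theta> :: "real \<Rightarrow> real" where
  "\<Theta> z = (\<Prod>p | prime p \<and> real p \<le> z. 1 - 1 / real p)"

text \<open>
  For \<open>t \<ge> exp 2\<close> the prime \<open>2\<close> qualifies, since \<open>\<Theta> 2 = 1/2\<close>, and only finitely many primes
  qualify, since \<open>\<Theta> z\<close> tends to \<open>0\<close>; hence the greatest one exists. For smaller \<open>t\<close> the value is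
  unspecified and never used.
\<close>

definition sieve_limit :: "real \<Rightarrow> nat" where
  "sieve_limit t = (GREATEST z. prime z \<and> inverse (\<Theta> (real z)) \<le> ln t)"

definition random_primes :: "(nat \<Rightarrow> int) \<Rightarrow> nat set" where
  "random_primes a =
     {n. real n \<ge> exp 2 \<and> int n \<in> sifted a (real (sieve_limit (real n)))}"

end

theory Submission
  imports Defs
begin

text \<open>
  The indicators of the events \<open>n \<in> \<R>\<close> have mean \<open>w(n) = \<Theta>(z(n))\<close>, which exceeds \<open>1 / log n\<close> by at
  most about \<open>1 / (z(n) log n)\<close>. The means therefore add up to the logarithmic integral up to
  \<open>O(\<surd>x)\<close> as soon as the prime following \<open>z(n)\<close> exceeds \<open>\<surd>n\<close>, and this follows from
  \<open>1 / \<Theta>(z) \<le> 2 log z\<close> for large \<open>z\<close>; here it matters that the constant in Mertens' theorem is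
  below \<open>2\<close>.

  The correlation of \<open>n\<close> and \<open>m\<close> is a product over primes \<open>p\<close> of \<open>1 + \<epsilon>\<^sub>p(n - m)\<close>, which expands into
  nonnegative combinations of the indicators of \<open>d | n - m\<close>. Summing by the largest prime involved,
  the variance of the number of survivors in a block of length \<open>H\<close> is \<open>O(H)\<close>. The
  Rademacher--Menshov inequality on the dyadic shells \<open>[2\<^sup>k, 2\<^sup>k\<^sup>+\<^sup>1)\<close> costs a factor \<open>k\<^sup>2\<close>, so the sum of
  the second moments of the maxima divided by \<open>2\<^sup>k k\<^sup>2\<^sup>c\<close> converges for \<open>c > 3/2\<close>.
\<close>

section \<open>Upper bounds of Chebyshev and Mertens\<close>

text \<open>Why the constant 2: let q be the prime after \<open>z(n)\<close>. Maximality of the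
  cutoff puts the mean between \<open>1 / log n\<close> and \<open>1 / ((1 - 1/q) log n)\<close>. If
  \<open>1 / \<Theta>(z) <= kappa * log z\<close>, then \<open>q > n^(1/kappa)\<close>, so the
  excess adds up to at most the order of \<open>x^(1 - 1/kappa)\<close>; a square-root error
  tolerates exactly \<open>kappa = 2\<close>. The true constant is
  \<open>exp(gamma) = 1.781...\<close>, so explicit upper bounds suffice. Comparison with the Euler
  product at \<open>1 + lambda / log N\<close> yields \<open>exp(gamma + E1(lambda))\<close>, where
  \<open>E1\<close> is the exponential integral: \<open>lambda = 1\<close> gives 2.218, too large,
  while \<open>lambda = 2\<close> gives 1.870.

  Why the variance needs care: the expansion of the correlation has exponentially many terms, and
  the sieving limit varies with n. Only the factor at the largest prime q keeps its mean-zero form;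
  all other coefficients are nonnegative. A one-sided bound for each divisor sum is therefore
  enough, and the coefficients recombine into an Euler product of logarithmic size, which the
  squared density outweighs.\<close>

lemma finite_primes_le [simp]: "finite {p::nat. prime p \<and> p \<le> n}"
  by (rule finite_subset[of _ "{..n}"]) auto

lemma prod_primes_dvd:
  assumes "finite A" "\<And>p. p \<in> A \<Longrightarrow> prime p" "\<And>p. p \<in> A \<Longrightarrow> p dvd m"
  shows "(\<Prod>p\<in>A. p) dvd (m::nat)"
  using assms
proof (induction A)
  case (insert q A)
  have "coprime q (\<Prod>p\<in>A. p)"
  proof (rule prod_coprime_right)
    fix p assume "p \<in> A"
    then have "p \<noteq> q" using insert.hyps by blast
    then show "coprime q p"
      using insert.prems(1) \<open>p \<in> A\<close> by (intro primes_coprime) auto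
  qed
  then show ?case
    using insert by (simp add: divides_mult)
qed auto

text \<open>Such a prime divides the numerator \<open>fact (2 * m + 1)\<close> but neither factorial
  of the denominator.\<close>

lemma prime_dvd_odd_central_binomial:
  assumes "prime p" "m + 1 < p" "p \<le> 2 * m + 1"
  shows "p dvd ((2 * m + 1) choose m)"
proof -
  have "fact m * fact (m + 1) * ((2 * m + 1) choose m) = (fact (2 * m + 1) :: nat)"
    using binomial_fact_lemma[of m "2 * m + 1"] by (simp add: mult.commute mult.left_commute)
  moreover have "p dvd (fact (2 * m + 1) :: nat)"
    using assms by (subst prime_dvd_fact_iff) auto
  ultimately have "p dvd fact m * fact (m + 1) * ((2 * m + 1) choose m)"
    by metis
  moreover have "\<not> p dvd fact m" "\<not> p dvd fact (m + 1)"
    using assms by (subst prime_dvd_fact_iff; simp)+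
  ultimately show ?thesis
    using assms(1) by (metis prime_dvd_mult_iff)
qed

text \<open>By symmetry, half of the binomial row of order \<open>2 * m + 1\<close> adds up to
  \<open>2 ^ (2 * m)\<close>, and the coefficient is one of its terms.\<close>

lemma odd_central_binomial_le: "((2 * m + 1) choose m) \<le> (4::nat) ^ m"
proof -
  have "((2 * m + 1) choose m) \<le> (\<Sum>k\<le>m. ((2 * m + 1) choose k))"
    by (rule member_le_sum) auto
  also have "\<dots> = 4 ^ m"
    by (simp only: binomial_r_part_sum) (simp add: power_mult)
  finally show ?thesis .
qed

text \<open>Erdos' induction: an even \<open>n > 2\<close> brings no new prime, and for
  \<open>n = 2 * m + 1\<close> the primes above \<open>m + 1\<close> together divide a binomial
  coefficient of size at most \<open>4 ^ m\<close>, while the others fall under the hypothesis at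
  \<open>m + 1\<close>.\<close>

lemma primorial_le: "(\<Prod>p | prime p \<and> p \<le> n. p) \<le> (4::nat) ^ n"
proof (induction n rule: less_induct)
  case (less n)
  consider "n \<le> 1" | "n = 2" | "n > 2" "even n" | m where "n = 2 * m + 1" "m \<ge> 1"
    by (cases "even n") (force elim!: oddE, metis One_nat_def add.commute less_one mult_0_right nat_neq_iff not_less oddE plus_1_eq_Suc)
  then show ?case
  proof cases
    case 1
    then have "\<not> (prime p \<and> p \<le> n)" for p
      using prime_ge_2_nat[of p] by linarith
    then have "{p. prime p \<and> p \<le> n} = {}" by blast
    then show ?thesis by (simp only: prod.empty) simp
  next
    case 2
    have "p = 2" if "prime p" "p \<le> 2" for p :: nat
      using prime_ge_2_nat[of p] that by linarith
    then have "{p::nat. prime p \<and> p \<le> 2} = {2}"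
      using two_is_prime_nat by blast
    then show ?thesis using 2 by (simp only: prod.insert prod.empty) simp
  next
    case 3
    have "prime p \<and> p \<le> n \<longleftrightarrow> prime p \<and> p \<le> n - 1" for p
      using 3 prime_odd_nat[of p] by (cases "p = n") auto
    then have "{p. prime p \<and> p \<le> n} = {p. prime p \<and> p \<le> n - 1}"
      by simp
    then have "(\<Prod>p | prime p \<and> p \<le> n. p) \<le> 4 ^ (n - 1)"
      using less[of "n - 1"] 3 by simp
    also have "\<dots> \<le> 4 ^ n" by (rule power_increasing) auto
    finally show ?thesis .
  next
    case 4
    let ?B = "{p. prime p \<and> m + 1 < p \<and> p \<le> 2 * m + 1}"
    have fin: "finite ?B" by (rule finite_subset[of _ "{..2*m+1}"]) auto
    have "(\<Prod>p\<in>?B. p) dvd ((2 * m + 1) choose m)"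
      using fin by (rule prod_primes_dvd) (use prime_dvd_odd_central_binomial in auto)
    then have B: "(\<Prod>p\<in>?B. p) \<le> 4 ^ m"
      by (rule order.trans[OF dvd_imp_le odd_central_binomial_le]) (simp add: zero_less_binomial)
    have "{p. prime p \<and> p \<le> n} = {p. prime p \<and> p \<le> m + 1} \<union> ?B"
      unfolding 4 by auto
    then have "(\<Prod>p | prime p \<and> p \<le> n. p) = (\<Prod>p | prime p \<and> p \<le> m + 1. p) * (\<Prod>p\<in>?B. p)"
      using fin by (simp only:) (rule prod.union_disjoint; force)
    also have "\<dots> \<le> 4 ^ (m + 1) * 4 ^ m"
      using less[of "m + 1"] 4 B by (intro mult_le_mono) auto
    also have "\<dots> = 4 ^ n" using 4 by (simp add: power_add mult_2)
    finally show ?thesis .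
  qed
qed

lemma sum_ln_primes_le: "(\<Sum>p | prime p \<and> p \<le> n. ln (real p)) \<le> real n * ln 4"
proof -
  have pos: "0 < (\<Prod>p | prime p \<and> p \<le> n. p)"
    by (rule prod_pos) (auto simp: prime_gt_0_nat)
  have "(\<Sum>p | prime p \<and> p \<le> n. ln (real p)) = ln (\<Prod>p | prime p \<and> p \<le> n. real p)"
    by (subst ln_prod) (auto simp: prime_gt_0_nat)
  also have "\<dots> = ln (real (\<Prod>p | prime p \<and> p \<le> n. p))" by simp
  also have "\<dots> \<le> ln (real (4 ^ n))"
    using pos primorial_le[of n] by (intro ln_mono) (auto simp del: of_nat_prod of_nat_power)
  also have "\<dots> = real n * ln 4" by (simp add: ln_realpow)
  finally show ?thesis .
qed

lemma sum_ln_prime_divisors_le: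
  assumes "m > 0"
  shows "(\<Sum>p | prime p \<and> p dvd m. ln (real p)) \<le> ln (real m)"
proof -
  have fin: "finite {p. prime p \<and> p dvd m}"
    using assms by (intro finite_subset[OF _ finite_divisors_nat[of m]]) auto
  have "(\<Prod>p | prime p \<and> p dvd m. p) dvd m"
    using fin by (rule prod_primes_dvd) simp_all
  then have "(\<Prod>p | prime p \<and> p dvd m. p) \<le> m"
    using assms by (rule dvd_imp_le)
  moreover have "0 < (\<Prod>p | prime p \<and> p dvd m. p)"
    by (rule prod_pos) (auto simp: prime_gt_0_nat)
  ultimately have "ln (real (\<Prod>p | prime p \<and> p dvd m. p)) \<le> ln (real m)"
    by (intro ln_mono) (auto simp del: of_nat_prod)
  moreover have "ln (real (\<Prod>p | prime p \<and> p dvd m. p)) = (\<Sum>p | prime p \<and> p dvd m. ln (real p))"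
    unfolding of_nat_prod by (subst ln_prod) (auto simp: prime_gt_0_nat fin)
  ultimately show ?thesis by simp
qed

lemma card_multiples:
  assumes "d > 0" shows "card {m\<in>{1..n}. d dvd m} = n div (d::nat)"
proof -
  have "{m\<in>{1..n}. d dvd m} = (\<lambda>k. d * k) ` {1..n div d}"
    using assms by (auto simp: less_eq_div_iff_mult_less_eq mult.commute elim!: dvdE)
  moreover have "inj_on (\<lambda>k. d * k) {1..n div d}"
    using assms by (auto intro: inj_onI)
  ultimately show ?thesis by (simp add: card_image)
qed

text \<open>Count \<open>ln p\<close> over all pairs \<open>p dvd m\<close> with
  \<open>m \<le> n\<close> in two ways: the total is at most \<open>n * ln n\<close>, and it equals
  the sum of \<open>ln p * (n div p)\<close>. Replacing \<open>n div p\<close> by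
  \<open>n / p\<close> costs at most one \<open>ln p\<close> per prime, which is where Chebyshev's
  \<open>ln 4\<close> enters.\<close>

lemma mertens_first_upper:
  assumes "n \<ge> 1"
  shows "(\<Sum>p | prime p \<and> p \<le> n. ln (real p) / real p) \<le> ln (real n) + ln 4"
proof -
  let ?P = "{p. prime p \<and> p \<le> n}"
  have "(\<Sum>p\<in>?P. ln (real p) * real (n div p)) =
        (\<Sum>p\<in>?P. \<Sum>m\<in>{1..n}. if p dvd m then ln (real p) else 0)"
  proof (rule sum.cong[OF refl])
    fix p assume "p \<in> ?P"
    then show "ln (real p) * real (n div p) = (\<Sum>m\<in>{1..n}. if p dvd m then ln (real p) else 0)"
      using card_multiples[of p n] by (simp add: sum.If_cases Int_def prime_gt_0_nat)
  qed
  also have "\<dots> = (\<Sum>m\<in>{1..n}. \<Sum>p\<in>?P. if p dvd m then ln (real p) else 0)"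
    by (rule sum.swap)
  also have "\<dots> = (\<Sum>m\<in>{1..n}. \<Sum>p | prime p \<and> p dvd m. ln (real p))"
  proof (rule sum.cong[OF refl])
    fix m assume m: "m \<in> {1..n}"
    then have "?P \<inter> {p. p dvd m} = {p. prime p \<and> p dvd m}"
      by (auto dest: dvd_imp_le)
    then show "(\<Sum>p\<in>?P. if p dvd m then ln (real p) else 0) = (\<Sum>p | prime p \<and> p dvd m. ln (real p))"
      by (simp add: sum.If_cases)
  qed
  also have "\<dots> \<le> (\<Sum>m\<in>{1..n}. ln (real m))"
    by (intro sum_mono sum_ln_prime_divisors_le) auto
  also have "\<dots> \<le> (\<Sum>m\<in>{1..n}. ln (real n))"
    by (intro sum_mono) auto
  finally have 1: "(\<Sum>p\<in>?P. ln (real p) * real (n div p)) \<le> real n * ln (real n)" by simp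
  have "real n * (\<Sum>p\<in>?P. ln (real p) / real p) =
      (\<Sum>p\<in>?P. ln (real p) * (real n / real p))"
    by (simp add: sum_distrib_left field_simps)
  also have "\<dots> \<le> (\<Sum>p\<in>?P. ln (real p) * (real (n div p) + 1))"
  proof (intro sum_mono mult_left_mono)
    fix p assume "p \<in> ?P"
    then have p: "p > 0" by (simp add: prime_gt_0_nat)
    have "n \<le> p * (n div p + 1)"
      using p by (metis less_imp_le dividend_less_times_div mult.commute add.commute mult_Suc_right Suc_eq_plus1)
    then have "real n \<le> real p * (real (n div p) + 1)"
      by (metis of_nat_le_iff of_nat_mult of_nat_add of_nat_1)
    then show "real n / real p \<le> real (n div p) + 1"
      using p by (simp add: field_simps)
    show "0 \<le> ln (real p)" using \<open>p \<in> ?P\<close> prime_ge_1_nat[of p] by simp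
  qed
  also have "\<dots> \<le> real n * ln (real n) + real n * ln 4"
    using 1 sum_ln_primes_le[of n] by (simp add: distrib_left sum.distrib)
  finally show ?thesis
    using assms by (simp flip: distrib_left)
qed

section \<open>Partial summation, and the Euler product to the right of 1\<close>

text \<open>One-sided summation by parts: since the partial sums are bounded only from above, the
  weights have to be nonincreasing and nonnegative. It serves both for sums over primes and for
  counts in residue classes.\<close>

lemma abel_sum_le:
  fixes w b :: "nat \<Rightarrow> real"
  assumes anti: "\<And>i. s \<le> i \<Longrightarrow> Suc i < t \<Longrightarrow> w (Suc i) \<le> w i"
    and nonneg: "\<And>i. s \<le> i \<Longrightarrow> i < t \<Longrightarrow> 0 \<le> w i"
    and partial: "\<And>k. s < k \<Longrightarrow> k \<le> t \<Longrightarrow> (\<Sum>i\<in>{s..<k}. b i) \<le> B"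
    and "s < t"
  shows "(\<Sum>i\<in>{s..<t}. w i * b i) \<le> w s * B"
proof -
  \<comment> \<open>The slack \<open>partial sum - B\<close> is nonpositive, so lowering its weight
    from \<open>w k\<close> to \<open>w (Suc k)\<close> only increases the right-hand side.\<close>
  have *: "(\<Sum>i\<in>{s..<Suc k}. w i * b i) \<le> w s * B + w k * ((\<Sum>i\<in>{s..<Suc k}. b i) - B)"
    if "s \<le> k" "Suc k \<le> t" for k
    using that
  proof (induction k rule: dec_induct)
    case base
    show ?case by (simp add: algebra_simps)
  next
    case (step k)
    have "w k * ((\<Sum>i\<in>{s..<Suc k}. b i) - B) \<le> w (Suc k) * ((\<Sum>i\<in>{s..<Suc k}. b i) - B)"
      using step anti[of k] partial[of "Suc k"] by (intro mult_right_mono_neg) auto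
    moreover have "(\<Sum>i\<in>{s..<Suc k}. w i * b i) \<le> w s * B + w k * ((\<Sum>i\<in>{s..<Suc k}. b i) - B)"
      using step by simp
    ultimately show ?case
      using step(1) by (simp add: algebra_simps)
  qed
  obtain k where k: "t = Suc k" "s \<le> k" using \<open>s < t\<close> by (cases t) auto
  have "w k * ((\<Sum>i\<in>{s..<t}. b i) - B) \<le> 0"
    using nonneg[of k] partial[of t] k by (intro mult_nonneg_nonpos) auto
  then show ?thesis using *[of k] k by simp
qed

lemma powr_diff_ge:
  fixes d :: real assumes "d > 0" "n \<ge> 1"
  shows "d * real (Suc n) powr (-(1 + d)) \<le> real n powr (-d) - real (Suc n) powr (-d)"
proof -
  have "\<exists>z. real n < z \<and> z < real (Suc n) \<and> real (Suc n) powr (-d) - real n powr (-d) =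
      (real (Suc n) - real n) * (-d * z powr (-d - 1))"
    using assms by (intro MVT2) (auto intro!: derivative_eq_intros)
  then obtain z where z: "real n < z" "z < real (Suc n)"
    "real (Suc n) powr (-d) - real n powr (-d) = - d * z powr (-d - 1)" by auto
  have "real (Suc n) powr (- d - 1) \<le> z powr (- d - 1)"
    using z assms powr_mono2'[of "- d - 1" z "real (Suc n)"] by simp
  moreover have "-(1 + d) = - d - 1" by simp
  ultimately have "real (Suc n) powr (-(1 + d)) \<le> z powr (- d - 1)" by metis
  then have "d * real (Suc n) powr (-(1 + d)) \<le> d * z powr (-d - 1)"
    using assms by (intro mult_left_mono) auto
  then show ?thesis using z(3) by linarith
qed

text \<open>Comparison with the integral of \<open>x powr (-(1 + d))\<close>, in telescoped form;
  the first term accounts for the 1.\<close>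

lemma zeta_partial_sum_le:
  fixes d :: real assumes "d > 0"
  shows "(\<Sum>n\<in>{1..N}. real n powr (-(1 + d))) \<le> 1 + 1 / d"
proof (cases "N \<ge> 1")
  case True
  have "d * (\<Sum>n\<in>{1..N}. real n powr (-(1 + d))) \<le> d + 1 - real N powr (-d)"
    using True
  proof (induction N rule: dec_induct)
    case (step N)
    have "{1..Suc N} = insert (Suc N) {1..N}" by auto
    then show ?case
      using step powr_diff_ge[of d N] assms by (simp add: distrib_left)
  qed simp
  also have "\<dots> \<le> d + 1" by simp
  finally show ?thesis using assms by (simp add: field_simps)
qed (use assms in auto)

text \<open>A multiple of q avoiding A is q times a number avoiding A, as no prime of A divides q.
  The truncation drops from N to \<open>N div q\<close>, so the Euler factor does not split off
  exactly at finite N.\<close>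

lemma sum_sifted_multiples:
  fixes f :: "nat \<Rightarrow> real"
  assumes "finite A" "\<And>p. p \<in> A \<Longrightarrow> prime p" "prime q" "q \<notin> A"
    and mult: "\<And>m. f (q * m) = c * f m"
  shows "(\<Sum>n | n \<in> {1..N} \<and> (\<forall>p\<in>insert q A. \<not> p dvd n). f n) =
    (\<Sum>n | n \<in> {1..N} \<and> (\<forall>p\<in>A. \<not> p dvd n). f n) -
    c * (\<Sum>n | n \<in> {1..N div q} \<and> (\<forall>p\<in>A. \<not> p dvd n). f n)"
proof -
  have q: "q > 0" using assms by (simp add: prime_gt_0_nat)
  have npq: "\<not> p dvd q" if "p \<in> A" for p
    using that assms primes_dvd_imp_eq by blast
  let ?S = "{n. n \<in> {1..N} \<and> (\<forall>p\<in>A. \<not> p dvd n)}"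
  let ?T = "{n. n \<in> {1..N div q} \<and> (\<forall>p\<in>A. \<not> p dvd n)}"
  have img: "?S \<inter> {n. q dvd n} = (\<lambda>m. q * m) ` ?T"
  proof (intro equalityI subsetI)
    fix n assume n: "n \<in> ?S \<inter> {n. q dvd n}"
    then obtain m where m: "n = q * m" by auto
    have "m \<le> N div q" "1 \<le> m"
      using n q m by (auto simp: less_eq_div_iff_mult_less_eq mult.commute)
    then have "m \<in> ?T" using n m by auto
    then show "n \<in> (\<lambda>m. q * m) ` ?T" using m by blast
  next
    fix n assume "n \<in> (\<lambda>m. q * m) ` ?T"
    then obtain m where m: "n = q * m" "m \<in> ?T" by blast
    have "q * m \<le> N" using m q by (auto simp: less_eq_div_iff_mult_less_eq mult.commute)
    moreover have "\<not> p dvd q * m" if "p \<in> A" for p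
      using m that npq[OF that] assms(2)[OF that] by (auto simp: prime_dvd_mult_iff)
    ultimately show "n \<in> ?S \<inter> {n. q dvd n}" using m q by auto
  qed
  have "inj_on (\<lambda>m. q * m) ?T" using q by (auto intro: inj_onI)
  then have "(\<Sum>n\<in>?S \<inter> {n. q dvd n}. f n) = c * (\<Sum>n\<in>?T. f n)"
    unfolding img by (simp add: sum.reindex mult sum_distrib_left)
  moreover have "(\<Sum>n\<in>?S. f n) = (\<Sum>n\<in>?S \<inter> {n. q dvd n}. f n) + (\<Sum>n\<in>?S - {n. q dvd n}. f n)"
    by (subst sum.union_disjoint[symmetric]) (auto intro!: sum.cong)
  moreover have "?S - {n. q dvd n} = {n. n \<in> {1..N} \<and> (\<forall>p\<in>insert q A. \<not> p dvd n)}"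
    by auto
  ultimately show ?thesis by simp
qed

text \<open>
  Removing the multiples of one prime after another multiplies the zeta sum by the Euler factors,
  and \<open>n = 1\<close> always survives.
\<close>
lemma euler_product_lower:
  fixes d :: real
  assumes "d > 0" "finite A" "\<And>p. p \<in> A \<Longrightarrow> prime p"
  shows "1 \<le> (1 + 1 / d) * (\<Prod>p\<in>A. 1 - real p powr (-(1 + d)))"
proof -
  define f where "f n = real n powr (-(1 + d))" for n
  define G where "G A N = (\<Sum>n | n \<in> {1..N} \<and> (\<forall>p\<in>A. \<not> p dvd n). f n)" for A :: "nat set" and N
  have G0: "G {} N = (\<Sum>n\<in>{1..N}. f n)" for N
    unfolding G_def by (rule sum.cong) auto
  have "incseq (G {})"
    unfolding G0 by (auto intro!: incseq_SucI simp: f_def)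
  moreover have "G {} N \<le> 1 + 1 / d" for N
    unfolding G0 f_def using zeta_partial_sum_le[OF assms(1)] .
  ultimately obtain Z where Z: "G {} \<longlonglongrightarrow> Z"
    using incseq_convergent by metis
  have "Z \<le> 1 + 1 / d"
    using Z by (rule LIMSEQ_le_const2) (use \<open>\<And>N. G {} N \<le> 1 + 1 / d\<close> in blast)
  \<comment> \<open>In the limit the truncations at N and at \<open>N div q\<close> agree, which is
    why the induction runs over limits and not over partial sums.\<close>
  have lim: "G A \<longlonglongrightarrow> Z * (\<Prod>p\<in>A. 1 - real p powr (-(1 + d)))"
    using assms(2,3)
  proof (induction A)
    case empty
    show ?case using Z by simp
  next
    case (insert q A)
    have q: "prime q" using insert by simp
    have "G (insert q A) N = G A N - f q * G A (N div q)" for N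
      unfolding G_def by (rule sum_sifted_multiples) (use insert in \<open>auto simp: f_def powr_mult\<close>)
    then have eq: "G (insert q A) = (\<lambda>N. G A N - f q * G A (N div q))" by blast
    have IH: "G A \<longlonglongrightarrow> Z * (\<Prod>p\<in>A. 1 - real p powr (-(1 + d)))"
      using insert.IH insert.prems by blast
    have "filterlim (\<lambda>N. N div q) at_top sequentially"
      using q prime_gt_0_nat by (simp add: filterlim_at_top_div_const_nat)
    then have "(\<lambda>N. G A (N div q)) \<longlonglongrightarrow> Z * (\<Prod>p\<in>A. 1 - real p powr (-(1 + d)))"
      by (rule filterlim_compose[OF IH])
    then have "G (insert q A) \<longlonglongrightarrow> Z * (\<Prod>p\<in>A. 1 - real p powr (-(1 + d))) -
        f q * (Z * (\<Prod>p\<in>A. 1 - real p powr (-(1 + d))))"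
      unfolding eq by (intro tendsto_intros IH)
    then show ?case using insert.hyps by (simp add: f_def algebra_simps)
  qed
  have "1 \<le> G A N" if "N \<ge> 1" for N
  proof -
    have "f 1 \<le> G A N"
      unfolding G_def
    proof (rule member_le_sum)
      have "\<not> p dvd 1" if "p \<in> A" for p
        using assms(3)[OF that] by (simp add: prime_nat_iff)
      then show "1 \<in> {n. n \<in> {1..N} \<and> (\<forall>p\<in>A. \<not> p dvd n)}"
        using that by simp
    qed (simp_all add: f_def)
    then show ?thesis by (simp add: f_def)
  qed
  then have "1 \<le> Z * (\<Prod>p\<in>A. 1 - real p powr (-(1 + d)))"
    using lim by (intro LIMSEQ_le_const) auto
  also have "\<dots> \<le> (1 + 1 / d) * (\<Prod>p\<in>A. 1 - real p powr (-(1 + d)))"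
  proof (intro mult_right_mono prod_nonneg)
    fix p assume "p \<in> A"
    then have "real p \<ge> 1" using assms(3)[of p] prime_ge_1_nat[of p] by simp
    then show "0 \<le> 1 - real p powr (-(1 + d))"
      using powr_mono[of "-(1+d)" 0 "real p"] assms(1) by simp
  qed fact
  finally show ?thesis .
qed

section \<open>The constant in Mertens' product\<close>

text \<open>Taylor polynomial of \<open>(1 - exp (-2 v)) / v\<close>. It ends with a positive term,
  so that it bounds the function from above; ending at degree 2 would replace \<open>599/450\<close>
  below by \<open>13/9\<close>, which already exceeds \<open>ln 4\<close>.\<close>

definition einP :: "real \<Rightarrow> real" where
  "einP v = 2 - 2 * v + 4/3 * v^2 - 2/3 * v^3 + 4/15 * v^4"

text \<open>The antiderivative of \<open>einP\<close> that vanishes at 0. Its value at 1 is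
  \<open>599/450\<close>, slightly above the integral 1.3192... of the original function.\<close>

definition einQ :: "real \<Rightarrow> real" where
  "einQ v = 2 * v - v^2 + 4/9 * v^3 - 1/6 * v^4 + 4/75 * v^5"

lemma one_minus_exp_le_einP: "1 - exp (- (2 * v)) \<le> v * einP v"
proof -
  obtain t where t: "exp (- (2 * v)) = (\<Sum>m<6. ((- (2 * v)) ^ m) / fact m) + (exp t / fact 6) * (- (2 * v)) ^ 6"
    using Maclaurin_exp_le[of "- (2 * v)" 6] by blast
  have "0 \<le> (exp t / fact 6) * (- (2 * v)) ^ 6" by (intro mult_nonneg_nonneg) auto
  then have "(\<Sum>m<6. ((- (2 * v)) ^ m) / fact m) \<le> exp (- (2 * v))" using t by linarith
  then show ?thesis
    by (simp add: einP_def numeral_eq_Suc fact_Suc algebra_simps)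
qed

lemma DERIV_einQ: "(einQ has_real_derivative einP v) (at v)"
  unfolding einQ_def einP_def by (auto intro!: derivative_eq_intros)

lemma einP_antimono:
  assumes "0 \<le> u" "u \<le> v" "v \<le> 1"
  shows "einP v \<le> einP u"
proof (rule DERIV_nonpos_imp_nonincreasing[OF assms(2)])
  fix x assume x: "u \<le> x" "x \<le> v"
  let ?D = "-2 + 8/3 * x - 2 * x^2 + 16/15 * x^3"
  have "(einP has_real_derivative ?D) (at x)"
    unfolding einP_def by (auto intro!: derivative_eq_intros simp: algebra_simps)
  moreover have "?D \<le> 0"
  proof -
    \<comment> \<open>Lowering the cubic term to a quadratic one leaves a quadratic without real
      roots; completing the square shows its sign.\<close>
    have "x^2 * x \<le> x^2 * 1" using x assms by (intro mult_left_mono) auto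
    then have "?D \<le> -2 + 8/3 * x - 14/15 * x^2" by (simp add: power3_eq_cube power2_eq_square)
    also have "\<dots> = - (14/15) * (x - 10/7)^2 - 2/21"
      by (simp add: power2_eq_square field_simps)
    also have "\<dots> \<le> 0"
      using zero_le_power2[of "x - 10/7"] by linarith
    finally show ?thesis .
  qed
  ultimately show "\<exists>y. (einP has_real_derivative y) (at x) \<and> y \<le> 0" by blast
qed

lemma einP_bounds:
  assumes "0 \<le> v" "v \<le> 1" shows "0 \<le> einP v" "einP v \<le> 2"
proof -
  have "einP 1 = 14/15" "einP 0 = 2" by (simp_all add: einP_def)
  then show "0 \<le> einP v" "einP v \<le> 2"
    using einP_antimono[of v 1] einP_antimono[of 0 v] assms by linarith+
qed

text \<open>A right-endpoint rectangle lies below the graph of the decreasing function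
  \<open>einP\<close>.\<close>

lemma einQ_diff_ge:
  assumes "0 \<le> u" "u \<le> v" "v \<le> 1"
  shows "(v - u) * einP v \<le> einQ v - einQ u"
proof (cases "u = v")
  case False
  then have "\<exists>z. u < z \<and> z < v \<and> einQ v - einQ u = (v - u) * einP z"
    using assms by (intro MVT2 DERIV_einQ) auto
  then obtain z where z: "u < z" "z < v" "einQ v - einQ u = (v - u) * einP z" by blast
  have "(v - u) * einP v \<le> (v - u) * einP z"
    using z assms by (intro mult_left_mono einP_antimono) auto
  then show ?thesis using z by simp
qed simp

lemma sum_prime_eq: "(\<Sum>p | prime p \<and> p \<le> N. f p) = (\<Sum>n\<in>{2..<Suc N}. if prime n then f n else (0::real))"
proof -
  have "{2..<Suc N} \<inter> {n. prime n} = {p. prime p \<and> p \<le> N}"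
    using prime_ge_2_nat by auto
  then show ?thesis by (simp add: sum.If_cases del: sum.op_ivl_Suc)
qed

lemma sum_ln_diff:
  assumes "1 \<le> k" shows "(\<Sum>n\<in>{2..<Suc k}. g (real n) - g (real (n - 1))) = g (real k) - (g 1 :: real)"
  using assms by (induction k rule: dec_induct) (auto simp: sum.atLeastLessThan_Suc)

text \<open>Each term is at most \<open>ln p / p\<close> times the decreasing weight
  \<open>w p\<close>. Replacing the prime mass \<open>ln p / p\<close> by the increments of
  \<open>ln\<close> costs \<open>w 2 * ln 4\<close> by Mertens' first theorem and partial summation;
  what remains is a Riemann sum for the integral of \<open>einP\<close> over
  \<open>[0, 1]\<close>.\<close>

lemma sum_one_minus_powr_div_prime_le:
  assumes "N \<ge> 2"
  shows "(\<Sum>p | prime p \<and> p \<le> N. (1 - exp (- (2 * (ln (real p) / ln (real N))))) / real p)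
    \<le> 599/450 + 2 * ln 4 / ln (real N)"
proof -
  define L where "L = ln (real N)"
  have L: "L > 0" using assms by (simp add: L_def)
  have lnL: "0 \<le> ln (real n) / L \<and> ln (real n) / L \<le> 1" if "1 \<le> n" "n \<le> N" for n
    using that L by (auto simp: L_def divide_simps)
  define w where "w n = einP (ln (real n) / L) / L" for n :: nat
  \<comment> \<open>Prime mass minus smooth mass. The partial sums of the smooth mass telescope to
    logarithms, so those of \<open>b\<close> are at most \<open>ln 4\<close>.\<close>
  define b where "b n = (if prime n then ln (real n) / real n else 0) - (ln (real n) - ln (real (n - 1)))" for n :: nat
  have "(\<Sum>p | prime p \<and> p \<le> N. (1 - exp (- (2 * (ln (real p) / L)))) / real p) \<le>
      (\<Sum>p | prime p \<and> p \<le> N. w p * (ln (real p) / real p))"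
  proof (rule sum_mono)
    fix p assume "p \<in> {p. prime p \<and> p \<le> N}"
    then have p: "real p > 0" by (simp add: prime_gt_0_nat)
    have "(1 - exp (- (2 * (ln (real p) / L)))) / real p \<le> (ln (real p) / L * einP (ln (real p) / L)) / real p"
      using p by (intro divide_right_mono one_minus_exp_le_einP) auto
    then show "(1 - exp (- (2 * (ln (real p) / L)))) / real p \<le> w p * (ln (real p) / real p)"
      by (simp add: w_def mult_ac)
  qed
  also have "\<dots> = (\<Sum>n\<in>{2..<Suc N}. w n * (if prime n then ln (real n) / real n else 0))"
    unfolding sum_prime_eq by (rule sum.cong) auto
  also have "\<dots> = (\<Sum>n\<in>{2..<Suc N}. w n * b n) + (\<Sum>n\<in>{2..<Suc N}. w n * (ln (real n) - ln (real (n - 1))))"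
    unfolding sum.distrib[symmetric] by (rule sum.cong) (auto simp: b_def algebra_simps)
  also have "(\<Sum>n\<in>{2..<Suc N}. w n * b n) \<le> w 2 * ln 4"
  proof (rule abel_sum_le)
    show "w (Suc i) \<le> w i" if "2 \<le> i" "Suc i < Suc N" for i
      unfolding w_def using that L lnL[of "Suc i"] lnL[of i]
      by (intro divide_right_mono einP_antimono) (auto simp: divide_right_mono)
    show "0 \<le> w i" if "2 \<le> i" "i < Suc N" for i
      unfolding w_def using that L lnL[of i] by (intro divide_nonneg_pos einP_bounds) auto
    show "(\<Sum>i\<in>{2..<k}. b i) \<le> ln 4" if k: "2 < k" "k \<le> Suc N" for k
    proof -
      obtain m where m: "k = Suc m" "m \<ge> 1" using k by (cases k) auto
      have "(\<Sum>i\<in>{2..<k}. b i) = (\<Sum>p | prime p \<and> p \<le> m. ln (real p) / real p) - ln (real m)"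
        unfolding b_def m sum_prime_eq using sum_ln_diff[OF m(2), of ln]
        by (simp add: sum_subtractf del: sum.op_ivl_Suc)
      then show ?thesis using mertens_first_upper[OF m(2)] by simp
    qed
  qed (use assms in auto)
  also have "w 2 * ln 4 \<le> 2 * ln 4 / L"
    unfolding w_def using L lnL[of 2] assms einP_bounds(2)[of "ln 2 / L"]
    by (simp add: divide_right_mono)
  also have "(\<Sum>n\<in>{2..<Suc N}. w n * (ln (real n) - ln (real (n - 1)))) \<le>
     (\<Sum>n\<in>{2..<Suc N}. einQ (ln (real n) / L) - einQ (ln (real (n - 1)) / L))"
  proof (rule sum_mono)
    fix n assume n: "n \<in> {2..<Suc N}"
    have "(ln (real n) / L - ln (real (n - 1)) / L) * einP (ln (real n) / L) \<le>
       einQ (ln (real n) / L) - einQ (ln (real (n - 1)) / L)"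
      using lnL[of n] lnL[of "n - 1"] n L by (intro einQ_diff_ge) (auto intro!: divide_right_mono)
    then show "w n * (ln (real n) - ln (real (n - 1))) \<le> einQ (ln (real n) / L) - einQ (ln (real (n - 1)) / L)"
      by (simp add: w_def diff_divide_distrib[symmetric] mult.commute)
  qed
  also have "\<dots> = einQ (ln (real N) / L) - einQ (ln 1 / L)"
    using sum_ln_diff[of N "\<lambda>x. einQ (ln x / L)"] assms by simp
  also have "\<dots> = 599/450"
    using L by (simp add: einQ_def flip: L_def)
  finally show ?thesis by (simp add: L_def)
qed

lemma ln_le_2_sqrt: "x > 0 \<Longrightarrow> ln x \<le> 2 * sqrt x"
  using ln_le_minus_one[of "sqrt x"] by (simp add: ln_sqrt)

text \<open>This bounds the cost of replacing \<open>1 / (p - 1)\<close> by \<open>1 / p\<close>.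
  The logarithm is traded for a square root, and comparison with \<open>n powr (-3/2)\<close>
  follows.\<close>

lemma sum_ln_div_square_bounded:
  "\<exists>K. \<forall>N. (\<Sum>p | prime p \<and> p \<le> N. ln (real p) / (real p * (real p - 1))) \<le> K"
proof (intro exI allI)
  fix N :: nat
  have summ: "summable (\<lambda>n. 4 * real n powr (-3/2))"
    by (intro summable_mult) (simp add: summable_real_powr_iff)
  have "(\<Sum>p | prime p \<and> p \<le> N. ln (real p) / (real p * (real p - 1))) \<le>
      (\<Sum>p | prime p \<and> p \<le> N. 4 * real p powr (-3/2))"
  proof (rule sum_mono)
    fix p assume "p \<in> {p. prime p \<and> p \<le> N}"
    then have p: "real p \<ge> 2" using prime_ge_2_nat[of p] by simp
    have "ln (real p) / (real p * (real p - 1)) \<le> (2 * sqrt (real p)) / (real p * (real p / 2))"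
      using p by (intro frac_le ln_le_2_sqrt mult_left_mono) auto
    also have "\<dots> = 4 * (real p powr (1/2) / real p powr 2)"
      using p by (simp add: powr_half_sqrt powr_numeral power2_eq_square)
    also have "\<dots> = 4 * real p powr (-3/2)"
      by (subst powr_diff[symmetric]) simp
    finally show "ln (real p) / (real p * (real p - 1)) \<le> 4 * real p powr (-3/2)" .
  qed
  also have "\<dots> \<le> (\<Sum>n. 4 * real n powr (-3/2))"
    using summ by (rule sum_le_suminf) auto
  finally show "(\<Sum>p | prime p \<and> p \<le> N. ln (real p) / (real p * (real p - 1))) \<le> (\<Sum>n. 4 * real n powr (-3/2))" .
qed

lemma Theta_nat: "\<Theta> (real N) = (\<Prod>p | prime p \<and> p \<le> N. 1 - 1 / real p)"
  by (simp add: \<Theta>_def)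

lemma Theta_pos: "\<Theta> (real N) > 0"
  unfolding Theta_nat
proof (rule prod_pos)
  fix p assume "p \<in> {p. prime p \<and> p \<le> N}"
  then show "0 < 1 - 1 / real p" using prime_gt_1_nat[of p] by simp
qed

text \<open>
  Comparing the product with the Euler product at \<open>1 + d\<close>, \<open>d = 2 / ln N\<close>, costs the factor
  \<open>exp (\<integral>\<^sub>0\<^sup>1 (1 - exp (-2 v)) / v dv)\<close>, and replacing the integrand by its Taylor
  polynomial \<open>einP\<close> keeps this factor below \<open>4\<close>.
\<close>
lemma inverse_Theta_le_aux:
  "\<exists>K. \<forall>N\<ge>2. inverse (\<Theta> (real N)) \<le> (1 + ln (real N) / 2) * exp (599/450 + K / ln (real N))"
proof -
  obtain K where K: "\<And>N. (\<Sum>p | prime p \<and> p \<le> N. ln (real p) / (real p * (real p - 1))) \<le> K"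
    using sum_ln_div_square_bounded by blast
  show ?thesis
  proof (intro exI allI impI)
    fix N :: nat assume N: "N \<ge> 2"
    define L where "L = ln (real N)"
    have L: "L > 0" using N by (simp add: L_def)
    let ?P = "{p. prime p \<and> p \<le> N}"
    define e where "e p = 1 - exp (- (2 * (ln (real p) / L)))" for p :: nat
    have "1 \<le> (1 + 1 / (2 / L)) * (\<Prod>p\<in>?P. 1 - real p powr (-(1 + 2 / L)))"
      using L by (intro euler_product_lower) auto
    also have "\<dots> \<le> (1 + 1 / (2 / L)) * (\<Prod>p\<in>?P. (1 - 1 / real p) * exp (e p / (real p - 1)))"
    proof (intro mult_left_mono prod_mono conjI)
      fix p assume "p \<in> ?P"
      then have p: "real p \<ge> 2" using prime_ge_2_nat[of p] by simp
      have pw: "real p powr (-(1 + 2 / L)) = (1 - e p) / real p"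
        using p by (simp add: e_def powr_def exp_diff algebra_simps exp_minus field_simps flip: exp_add)
      have "real p powr (-(1 + 2 / L)) \<le> real p powr 0"
        using p L divide_pos_pos[of 2 L] by (intro powr_mono) linarith+
      then show "0 \<le> 1 - real p powr (-(1 + 2 / L))" using p by simp
      \<comment> \<open>The Euler factor at 1 splits off exactly; the remaining factor is put under
        \<open>exp\<close>, so that the product over p becomes a sum in the exponent.\<close>
      have "1 - real p powr (-(1 + 2 / L)) = (1 - 1 / real p) * (1 + e p / (real p - 1))"
        unfolding pw using p by (simp add: field_simps)
      also have "\<dots> \<le> (1 - 1 / real p) * exp (e p / (real p - 1))"
        using p by (intro mult_left_mono exp_ge_add_one_self) auto
      finally show "1 - real p powr (-(1 + 2 / L)) \<le> (1 - 1 / real p) * exp (e p / (real p - 1))" .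
    qed (use L in auto)
    also have "\<dots> = (1 + L / 2) * (\<Theta> (real N) * exp (\<Sum>p\<in>?P. e p / (real p - 1)))"
      by (simp add: Theta_nat prod.distrib exp_sum)
    finally have 1: "1 \<le> (1 + L / 2) * (\<Theta> (real N) * exp (\<Sum>p\<in>?P. e p / (real p - 1)))" .
    have "(\<Sum>p\<in>?P. e p / (real p - 1)) \<le>
        (\<Sum>p\<in>?P. e p / real p + 2 / L * (ln (real p) / (real p * (real p - 1))))"
    proof (rule sum_mono)
      fix p assume "p \<in> ?P"
      then have p: "real p \<ge> 2" using prime_ge_2_nat[of p] by simp
      \<comment> \<open>With this linear bound the discrepancy \<open>1 / (p - 1) - 1 / p\<close>
        contributes only \<open>O(1 / L)\<close> in total.\<close>
      have "e p \<le> 2 / L * ln (real p)"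
        using exp_ge_add_one_self[of "- (2 * (ln (real p) / L))"] by (simp add: e_def)
      then have "e p / (real p * (real p - 1)) \<le> (2 / L * ln (real p)) / (real p * (real p - 1))"
        using p by (intro divide_right_mono) auto
      moreover have "e p / (real p - 1) = e p / real p + e p / (real p * (real p - 1))"
        using p by (simp add: field_simps)
      ultimately show "e p / (real p - 1) \<le> e p / real p + 2 / L * (ln (real p) / (real p * (real p - 1)))"
        by simp
    qed
    also have "\<dots> = (\<Sum>p\<in>?P. e p / real p) + 2 / L * (\<Sum>p\<in>?P. ln (real p) / (real p * (real p - 1)))"
      by (simp add: sum.distrib sum_distrib_left)
    also have "\<dots> \<le> (599/450 + 2 * ln 4 / L) + 2 / L * K"
      using sum_one_minus_powr_div_prime_le[OF N] K[of N] L
      by (intro add_mono mult_left_mono) (auto simp: e_def L_def)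
    also have "\<dots> = 599/450 + (2 * ln 4 + 2 * K) / L"
      by (simp add: add_divide_distrib)
    finally have "exp (\<Sum>p\<in>?P. e p / (real p - 1)) \<le> exp (599/450 + (2 * ln 4 + 2 * K) / L)" by simp
    then have "(1 + L / 2) * (\<Theta> (real N) * exp (\<Sum>p\<in>?P. e p / (real p - 1))) \<le>
       (1 + L / 2) * (\<Theta> (real N) * exp (599/450 + (2 * ln 4 + 2 * K) / L))"
      using L Theta_pos[of N] by (intro mult_left_mono) auto
    with 1 have "1 \<le> (1 + L / 2) * exp (599/450 + (2 * ln 4 + 2 * K) / L) * \<Theta> (real N)"
      by (simp add: mult_ac)
    then show "inverse (\<Theta> (real N)) \<le> (1 + ln (real N) / 2) * exp (599/450 + (2 * ln 4 + 2 * K) / ln (real N))"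
      using Theta_pos[of N] by (simp add: L_def field_simps)
  qed
qed

lemma eventually_inverse_Theta_le:
  "eventually (\<lambda>N. inverse (\<Theta> (real N)) \<le> 2 * ln (real N)) sequentially"
proof -
  obtain K where K: "\<And>N. N \<ge> 2 \<Longrightarrow> inverse (\<Theta> (real N)) \<le> (1 + ln (real N) / 2) * exp (599/450 + K / ln (real N))"
    using inverse_Theta_le_aux by blast
  have lim: "filterlim (\<lambda>N. ln (real N)) at_top sequentially"
    by (intro filterlim_compose[OF ln_at_top] filterlim_real_sequentially)
  then have i: "(\<lambda>N. inverse (ln (real N))) \<longlonglongrightarrow> 0"
    by (rule filterlim_compose[OF tendsto_inverse_0_at_top, of _ _, simplified] tendsto_inverse_0_at_top)
  have "(\<lambda>N. (inverse (ln (real N)) + 1 / 2) * exp (599/450 + K * inverse (ln (real N)))) \<longlonglongrightarrow>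
      (0 + 1 / 2) * exp (599/450 + K * 0)"
    by (intro tendsto_intros i)
  moreover have "(0 + 1 / 2) * exp (599/450 + K * 0) < 2"
  proof -
    \<comment> \<open>The limit is \<open>exp (599/450) / 2\<close>, so the constant stays below 2
      exactly if \<open>599/450 < ln 4\<close>. The elementary bound \<open>ln 2 \<ge> 2/3\<close>
      just suffices, because \<open>599/450 < 600/450 = 4/3\<close>.\<close>
    have "599/450 < 2 * ln (2::real)" using ln2_ge_two_thirds by simp
    also have "\<dots> = ln 4" using ln_realpow[of 2 2] by simp
    finally have "exp (599/450) < exp (ln (4::real))" by (subst exp_less_cancel_iff)
    then show ?thesis by simp
  qed
  ultimately have "eventually (\<lambda>N. (inverse (ln (real N)) + 1 / 2) * exp (599/450 + K * inverse (ln (real N))) < 2) sequentially"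
    by (rule order_tendstoD)
  then show ?thesis
    using eventually_ge_at_top[of 2]
  proof eventually_elim
    case (elim N)
    then have L: "ln (real N) > 0" by simp
    have "inverse (\<Theta> (real N)) \<le> (1 + ln (real N) / 2) * exp (599/450 + K / ln (real N))"
      using K elim by simp
    also have "\<dots> = ln (real N) * ((inverse (ln (real N)) + 1 / 2) * exp (599/450 + K * inverse (ln (real N))))"
      using L by (simp add: field_simps)
    also have "\<dots> \<le> ln (real N) * 2"
      using L elim by (intro mult_left_mono) auto
    finally show ?case by simp
  qed
qed

section \<open>Divergence of the inverse product\<close>

text \<open>Euler's argument with truncated sums, which avoids all questions of convergence: a
  number composed of primes in \<open>insert q A\<close> is either composed of primes in A or q
  times a smaller number of the same kind.\<close>

lemma sum_smooth_le:
  fixes N :: nat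
  assumes "finite A" "\<And>p. p \<in> A \<Longrightarrow> prime p"
  shows "(\<Sum>n | n \<in> {1..N} \<and> prime_factors n \<subseteq> A. 1 / real n) * (\<Prod>p\<in>A. 1 - 1 / real p) \<le> 1"
  using assms
proof (induction A)
  case empty
  have "{n. n \<in> {1..N} \<and> prime_factors n \<subseteq> {}} \<subseteq> {1}"
    by (auto simp: prime_factorization_empty_iff)
  then have "(\<Sum>n | n \<in> {1..N} \<and> prime_factors n \<subseteq> {}. 1 / real n) \<le> (\<Sum>n\<in>{1}. 1 / real n)"
    by (intro sum_mono2) auto
  then show ?case by simp
next
  case (insert q A)
  have q: "prime q" "q > 0" using insert by (auto simp: prime_gt_0_nat)
  let ?S = "{n. n \<in> {1..N} \<and> prime_factors n \<subseteq> insert q A}"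
  let ?T = "{n. n \<in> {1..N} \<and> prime_factors n \<subseteq> A}"
  have fin: "finite ?S" "finite ?T" by (auto intro: finite_subset[of _ "{1..N}"])
  \<comment> \<open>The set \<open>?S\<close> occurs on both sides; since its sum is finite, the
    resulting inequality can be solved for it and yields the factor \<open>1 - 1/q\<close>.\<close>
  have "?S \<subseteq> ?T \<union> (\<lambda>m. q * m) ` ?S"
  proof
    fix n assume n: "n \<in> ?S"
    show "n \<in> ?T \<union> (\<lambda>m. q * m) ` ?S"
    proof (cases "q dvd n")
      case True
      then obtain m where m: "n = q * m" by auto
      then have "m dvd n" by simp
      have "m \<noteq> 0" "m \<le> N" using n m q by (auto intro: order.trans[of m "q * m"])
      moreover have "prime_factors m \<subseteq> prime_factors n"
        using n m by (intro dvd_prime_factors) auto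
      ultimately have "m \<in> ?S" using n by auto
      then show ?thesis using m by blast
    next
      case False
      then have "q \<notin> prime_factors n" by (auto dest: in_prime_factors_imp_dvd)
      then show ?thesis using n by auto
    qed
  qed
  then have "(\<Sum>n\<in>?S. 1 / real n) \<le> (\<Sum>n\<in>?T \<union> (\<lambda>m. q * m) ` ?S. 1 / real n)"
    using fin by (intro sum_mono2) auto
  also have "\<dots> \<le> (\<Sum>n\<in>?T. 1 / real n) + (\<Sum>n\<in>(\<lambda>m. q * m) ` ?S. 1 / real n)"
    using fin sum_nonneg[of "?T \<inter> (\<lambda>m. q * m) ` ?S" "\<lambda>n. 1 / real n"] by (subst sum_Un) auto
  also have "(\<Sum>n\<in>(\<lambda>m. q * m) ` ?S. 1 / real n) = 1 / real q * (\<Sum>n\<in>?S. 1 / real n)"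
    using q by (subst sum.reindex) (auto intro!: inj_onI simp: sum_distrib_left)
  finally have "(\<Sum>n\<in>?S. 1 / real n) * (1 - 1 / real q) \<le> (\<Sum>n\<in>?T. 1 / real n)"
    by (simp add: algebra_simps)
  then have "(\<Sum>n\<in>?S. 1 / real n) * (1 - 1 / real q) * (\<Prod>p\<in>A. 1 - 1 / real p) \<le>
     (\<Sum>n\<in>?T. 1 / real n) * (\<Prod>p\<in>A. 1 - 1 / real p)"
    using insert(4) by (intro mult_right_mono prod_nonneg) (auto dest!: prime_ge_1_nat simp: divide_simps)
  also have "\<dots> \<le> 1" using insert by auto
  finally show ?case using insert by (simp add: mult_ac)
qed

text \<open>Every \<open>n \<le> N\<close> has only prime factors up to N. The resulting divergence
  keeps the cutoffs in \<open>sieve_limit\<close> bounded.\<close>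

lemma harm_le_inverse_Theta: "harm N \<le> inverse (\<Theta> (real N))"
proof -
  have eq: "{n. n \<in> {1..N} \<and> prime_factors n \<subseteq> {p. prime p \<and> p \<le> N}} = {1..N}"
  proof -
    have "prime_factors n \<subseteq> {p. prime p \<and> p \<le> N}" if n: "n \<in> {1..N}" for n
    proof
      fix p assume p: "p \<in> prime_factors n"
      then have "p dvd n" "prime p" by blast+
      moreover have "n > 0" "n \<le> N" using n by simp_all
      ultimately show "p \<in> {p. prime p \<and> p \<le> N}" using dvd_imp_le[of p n] by simp
    qed
    then show ?thesis by blast
  qed
  have "(\<Sum>n\<in>{1..N}. 1 / real n) * \<Theta> (real N) \<le> 1"
  proof -
    have "(\<Sum>n | n \<in> {1..N} \<and> prime_factors n \<subseteq> {p. prime p \<and> p \<le> N}. 1 / real n) * \<Theta> (real N) \<le> 1"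
      unfolding Theta_nat by (rule sum_smooth_le[OF finite_primes_le]) blast
    then show ?thesis by (simp only: eq)
  qed
  then have "harm N * \<Theta> (real N) \<le> 1"
    by (simp add: harm_def inverse_eq_divide)
  then show ?thesis
    using Theta_pos[of N] by (metis inverse_eq_divide pos_le_divide_eq)
qed

lemma inverse_Theta_at_top: "filterlim (\<lambda>N. inverse (\<Theta> (real N))) at_top sequentially"
  by (rule filterlim_at_top_mono[OF harm_at_top]) (intro always_eventually allI harm_le_inverse_Theta)

section \<open>The sieving limit\<close>

text \<open>\<open>exp 2\<close> lies between 7 and 8, so 8 is the least integer above the
  threshold; this is the source of every 8 below.\<close>

lemma ln_8_ge: "2 \<le> ln (8::real)"
proof -
  have "ln (8::real) = 3 * ln 2" using ln_realpow[of 2 3] by simp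
  then show ?thesis using ln2_ge_two_thirds by simp
qed

lemma ln_nat_ge_2:
  assumes "n \<ge> 8" shows "2 \<le> ln (real n)"
proof -
  have "ln 8 \<le> ln (real n)" using assms by (intro ln_mono) auto
  then show ?thesis using ln_8_ge by simp
qed

lemma Theta_antimono:
  assumes "m \<le> n" shows "\<Theta> (real n) \<le> \<Theta> (real m)"
proof -
  have bd: "0 \<le> 1 - 1 / real p" "1 - 1 / real p \<le> 1" if "prime p" for p
    using prime_gt_1_nat[OF that] by simp_all
  let ?A = "{p. prime p \<and> p \<le> m}" and ?B = "{p. prime p \<and> m < p \<and> p \<le> n}"
  have fin: "finite ?B" by (rule finite_subset[of _ "{..n}"]) auto
  have "{p. prime p \<and> p \<le> n} = ?A \<union> ?B" using assms by auto
  then have "\<Theta> (real n) = \<Theta> (real m) * (\<Prod>p\<in>?B. 1 - 1 / real p)"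
    unfolding Theta_nat using fin by (simp only:) (rule prod.union_disjoint; force)
  also have "\<dots> \<le> \<Theta> (real m) * 1"
    using Theta_pos[of m] bd by (intro mult_left_mono prod_le_1) auto
  finally show ?thesis by simp
qed

lemma inverse_Theta_mono: "m \<le> n \<Longrightarrow> inverse (\<Theta> (real m)) \<le> inverse (\<Theta> (real n))"
  by (intro le_imp_inverse_le Theta_antimono Theta_pos)

context
  fixes t :: real
  assumes t: "2 \<le> ln t"
begin

lemma sieve_limit_bound: "\<exists>b. \<forall>z. prime z \<and> inverse (\<Theta> (real z)) \<le> ln t \<longrightarrow> z \<le> b"
proof -
  have "eventually (\<lambda>N. inverse (\<Theta> (real N)) > ln t) sequentially"
    using inverse_Theta_at_top unfolding filterlim_at_top_dense by blast
  then obtain b where "\<And>z. z \<ge> b \<Longrightarrow> inverse (\<Theta> (real z)) > ln t"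
    unfolding eventually_sequentially by blast
  then have "z \<le> b" if "inverse (\<Theta> (real z)) \<le> ln t" for z
    using that by (meson linorder_not_le nle_le)
  then show ?thesis by blast
qed

lemma sieve_limit_prime: "prime (sieve_limit t)"
  and inverse_Theta_sieve_limit_le: "inverse (\<Theta> (real (sieve_limit t))) \<le> ln t"
proof -
  have "{p::nat. prime p \<and> p \<le> 2} = {2}"
    using prime_ge_2_nat by (auto intro: le_antisym)
  then have "\<Theta> (real 2) = 1 / 2" unfolding Theta_nat by simp
  then have "inverse (\<Theta> (real 2)) \<le> ln t"
    using t by (simp only:) simp
  then have two: "prime (2::nat) \<and> inverse (\<Theta> (real 2)) \<le> ln t"
    using two_is_prime_nat by blast
  obtain b where b: "\<And>z. prime z \<and> inverse (\<Theta> (real z)) \<le> ln t \<Longrightarrow> z \<le> b"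
    using sieve_limit_bound by blast
  have "prime (sieve_limit t) \<and> inverse (\<Theta> (real (sieve_limit t))) \<le> ln t"
    unfolding sieve_limit_def by (rule GreatestI_nat[of _ 2 b]) (use two b in blast)+
  then show "prime (sieve_limit t)" "inverse (\<Theta> (real (sieve_limit t))) \<le> ln t" by auto
qed

lemma sieve_limit_greatest:
  assumes "prime z" "inverse (\<Theta> (real z)) \<le> ln t"
  shows "z \<le> sieve_limit t"
proof -
  obtain b where b: "\<And>z. prime z \<and> inverse (\<Theta> (real z)) \<le> ln t \<Longrightarrow> z \<le> b"
    using sieve_limit_bound by blast
  show ?thesis
    unfolding sieve_limit_def by (rule Greatest_le_nat[of _ z b]) (use assms b in blast)+
qed

end

lemma sieve_limit_mono:
  assumes "2 \<le> ln t" "ln t \<le> ln u"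
  shows "sieve_limit t \<le> sieve_limit u"
  using sieve_limit_prime[of t] inverse_Theta_sieve_limit_le[of t] assms
  by (intro sieve_limit_greatest) auto

section \<open>How closely the density follows the inverse logarithm\<close>

definition survival_density :: "nat \<Rightarrow> real" where
  "survival_density n = \<Theta> (real (sieve_limit (real n)))"

lemma survival_density_pos: "survival_density n > 0"
  unfolding survival_density_def by (rule Theta_pos)

lemma survival_density_ge: "n \<ge> 8 \<Longrightarrow> 1 / ln (real n) \<le> survival_density n"
  using inverse_Theta_sieve_limit_le[of "real n"] ln_nat_ge_2[of n] survival_density_pos[of n]
  by (simp add: survival_density_def inverse_eq_divide divide_le_eq mult.commute)

lemma sieve_limit_nat_mono:
  assumes "8 \<le> m" "m \<le> n" shows "sieve_limit (real m) \<le> sieve_limit (real n)"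
  using assms ln_nat_ge_2[of m] by (intro sieve_limit_mono) auto

lemma survival_density_antimono: "8 \<le> m \<Longrightarrow> m \<le> n \<Longrightarrow> survival_density n \<le> survival_density m"
  unfolding survival_density_def by (intro Theta_antimono sieve_limit_nat_mono)

text \<open>Here q is the first prime after the sieving limit: it adds a single factor to the
  product, and maximality of the limit forces the new product below \<open>1 / ln n\<close>.\<close>

lemma survival_density_next_prime:
  assumes "n \<ge> 8"
  obtains q where "prime q" "survival_density n * (1 - 1 / real q) < 1 / ln (real n)"
    "ln (real n) < inverse (\<Theta> (real q))"
proof -
  define z where "z = sieve_limit (real n)"
  have ln: "2 \<le> ln (real n)" using ln_nat_ge_2[OF assms] .
  define q where "q = (LEAST q. prime q \<and> z < q)"
  have "\<exists>q. prime q \<and> z < q" using bigger_prime by blast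
  then have q: "prime q" "z < q" unfolding q_def by (metis (mono_tags, lifting) LeastI)+
  have "\<not> (prime p \<and> z < p)" if "p < q" for p
    using that not_less_Least unfolding q_def by blast
  then have "{p. prime p \<and> p \<le> q} = insert q {p. prime p \<and> p \<le> z}"
    using q by (auto simp: le_less not_less)
  then have eq: "\<Theta> (real q) = survival_density n * (1 - 1 / real q)"
    unfolding survival_density_def Theta_nat z_def[symmetric] using q(2) by (simp only:) simp
  have "\<not> inverse (\<Theta> (real q)) \<le> ln (real n)"
    using sieve_limit_greatest[OF ln q(1)] q(2) unfolding z_def by linarith
  then have gt: "ln (real n) < inverse (\<Theta> (real q))" by simp
  then have "\<Theta> (real q) < 1 / ln (real n)"
    using Theta_pos[of q] ln by (simp add: field_simps)
  then show ?thesis using that q(1) gt eq by simp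
qed

lemma survival_density_le:
  assumes "n \<ge> 8" shows "survival_density n \<le> 2 / ln (real n)"
proof -
  obtain q where q: "prime q" "survival_density n * (1 - 1 / real q) < 1 / ln (real n)"
    using survival_density_next_prime[OF assms] by metis
  have "real q \<ge> 2" using prime_ge_2_nat[OF q(1)] by simp
  then have "survival_density n * (1 / 2) \<le> survival_density n * (1 - 1 / real q)"
    using survival_density_pos[of n] by (intro mult_left_mono) (auto simp: field_simps)
  then show ?thesis using q(2) by linarith
qed

text \<open>The excess is at most \<open>survival_density n / q\<close> for the next prime q. From
  \<open>ln n < 1 / \<Theta>(q) \<le> 2 * ln q\<close> follows \<open>q > sqrt n\<close>.\<close>

lemma survival_density_approx:
  "eventually (\<lambda>n. survival_density n - 1 / ln (real n) \<le> 1 / sqrt (real n)) sequentially"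
proof -
  obtain z0 where z0: "\<And>N. N \<ge> z0 \<Longrightarrow> inverse (\<Theta> (real N)) \<le> 2 * ln (real N)"
    using eventually_inverse_Theta_le unfolding eventually_sequentially by blast
  have "filterlim (\<lambda>n. ln (real n)) at_top sequentially"
    by (intro filterlim_compose[OF ln_at_top] filterlim_real_sequentially)
  then have "eventually (\<lambda>n. ln (real n) \<ge> inverse (\<Theta> (real z0))) sequentially"
    unfolding filterlim_at_top by blast
  then show ?thesis using eventually_ge_at_top[of 8]
  proof eventually_elim
    case (elim n)
    obtain q where q: "prime q" "survival_density n * (1 - 1 / real q) < 1 / ln (real n)"
      "ln (real n) < inverse (\<Theta> (real q))"
      using survival_density_next_prime[OF elim(2)] by metis
    have ln: "2 \<le> ln (real n)" using ln_nat_ge_2[OF elim(2)] .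
    have q0: "real q > 0" using prime_gt_0_nat[OF q(1)] by simp
    \<comment> \<open>Otherwise \<open>1 / \<Theta>(q)\<close> would be at most
      \<open>1 / \<Theta>(z0)\<close>, hence at most \<open>ln n\<close>.\<close>
    have "z0 \<le> q"
      using inverse_Theta_mono[of q z0] q(3) elim(1) by force
    then have "ln (real n) < 2 * ln (real q)"
      using z0[of q] q(3) by linarith
    then have "ln (sqrt (real n)) < ln (real q)"
      using elim(2) by (simp add: ln_sqrt)
    then have sq: "sqrt (real n) < real q"
      using q0 elim(2) by (subst (asm) ln_less_cancel_iff) auto
    have "survival_density n - 1 / ln (real n) \<le> survival_density n * (1 / real q)"
      using q(2) by (simp add: algebra_simps)
    also have "\<dots> \<le> (2 / ln (real n)) * (1 / sqrt (real n))"
      using survival_density_le[OF elim(2)] survival_density_pos[of n] sq elim(2) ln q0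
      by (intro mult_mono divide_left_mono mult_pos_pos) (auto intro: order.strict_trans1[of 0])
    also have "\<dots> \<le> 1 * (1 / sqrt (real n))"
      using ln by (intro mult_right_mono) auto
    finally show ?case by simp
  qed
qed

section \<open>Correlations between sifted integers\<close>

lemma card_cong_lessThan:
  assumes "r < e" shows "card {m\<in>{..<k}. m mod e = r} = (k + (e - 1 - r)) div (e::nat)"
proof (induction k)
  case 0
  then show ?case using assms by simp
next
  case (Suc k)
  have e: "e > 0" using assms by simp
  have iff: "Suc (k + (e - 1 - r)) mod e = 0 \<longleftrightarrow> k mod e = r"
  proof -
    have "Suc (k + (e - 1 - r)) = k + (e - r)" using assms by simp
    moreover have "(k + (e - r)) mod e = 0 \<longleftrightarrow> k mod e = r"
    proof -
      have "[k + (e - r) = 0] (mod e) \<longleftrightarrow> [k + (e - r) + r = 0 + r] (mod e)"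
        by (simp only: cong_add_rcancel_nat)
      also have "\<dots> \<longleftrightarrow> [k + e = r] (mod e)" using assms by simp
      also have "\<dots> \<longleftrightarrow> k mod e = r" using assms by (simp add: cong_def)
      finally show ?thesis by (simp add: cong_def)
    qed
    ultimately show ?thesis by metis
  qed
  have set: "{m\<in>{..<Suc k}. m mod e = r} = (if k mod e = r then insert k {m\<in>{..<k}. m mod e = r} else {m\<in>{..<k}. m mod e = r})"
    by (auto simp: less_Suc_eq)
  have "Suc k + (e - 1 - r) = Suc (k + (e - 1 - r))" by simp
  then show ?case
    unfolding set using Suc iff by (simp add: div_Suc)
qed

text \<open>The count is a difference of two floors whose arguments differ by
  \<open>(k - s) / e\<close>, so it deviates from this quotient by at most 1, whatever the
  class.\<close>

lemma count_cong_bounds: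
  fixes e n s k :: nat
  assumes "e > 0" "s \<le> k"
  defines "c \<equiv> (\<Sum>m\<in>{s..<k}. of_bool [n = m] (mod e) :: real)"
  shows "c \<le> (real k - real s) / real e + 1" "(real k - real s) / real e - 1 \<le> c"
proof -
  define r where "r = n mod e"
  have r: "r < e" using assms by (simp add: r_def)
  define g where "g k = card {m\<in>{..<k}. m mod e = r}" for k
  define C where "C = real (e - 1 - r)"
  have "{m\<in>{..<k}. m mod e = r} = {m\<in>{..<s}. m mod e = r} \<union> {m\<in>{s..<k}. m mod e = r}"
    using assms(2) by auto
  then have "g k = g s + card {m\<in>{s..<k}. m mod e = r}"
    unfolding g_def by (simp only:) (rule card_Un_disjoint; force)
  moreover have "c = real (card {m\<in>{s..<k}. m mod e = r})"
    unfolding c_def r_def by (simp add: cong_def Int_def eq_commute conj_commute)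
  ultimately have c: "c = real (g k) - real (g s)" by simp
  have g: "real (g j) \<le> (real j + C) / real e" "(real j + C) / real e - 1 \<le> real (g j)" for j
  proof -
    have "g j = (j + (e - 1 - r)) div e" unfolding g_def using r by (rule card_cong_lessThan)
    then have "real (g j) = real_of_int \<lfloor>(real j + C) / real e\<rfloor>"
      using floor_divide_of_nat_eq[of "j + (e - 1 - r)" e, where 'a=real] by (simp add: C_def)
    then show "real (g j) \<le> (real j + C) / real e" "(real j + C) / real e - 1 \<le> real (g j)"
      by linarith+
  qed
  have "(real k + C) / real e - (real s + C) / real e = (real k - real s) / real e"
    by (simp flip: diff_divide_distrib)
  then show "c \<le> (real k - real s) / real e + 1" "(real k - real s) / real e - 1 \<le> c"
    unfolding c using g[of k] g[of s] by linarith+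
qed

text \<open>
  \<open>1 + pair_corr p n m\<close> is the probability that the class modulo \<open>p\<close> avoids both \<open>n\<close> and \<open>m\<close>,
  divided by \<open>(1 - 1 / p)\<^sup>2\<close>.
\<close>
definition pair_corr :: "nat \<Rightarrow> nat \<Rightarrow> nat \<Rightarrow> real" where
  "pair_corr p n m = real p / (real p - 1)^2 * (of_bool [n = m] (mod p) - 1 / real p)"

text \<open>Both coefficients are nonnegative for every prime (the second vanishes at
  \<open>p = 2\<close>). This positivity lets upper bounds pass through the expansion of the
  product.\<close>

lemma one_plus_pair_corr:
  assumes "prime p"
  shows "1 + pair_corr p n m = real p / (real p - 1)^2 * of_bool [n = m] (mod p) + (1 - 1 / (real p - 1)^2)"
proof -
  have "real p \<ge> 2" using prime_ge_2_nat[OF assms] by simp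
  then have "real p / (real p - 1)^2 * (1 / real p) = 1 / (real p - 1)^2" by simp
  then show ?thesis by (simp only: pair_corr_def right_diff_distrib)
qed

section \<open>Expansion of the correlation by its largest prime\<close>

lemma prod_primes_Suc:
  fixes f :: "nat \<Rightarrow> 'a::comm_monoid_mult"
  shows "(\<Prod>p | prime p \<and> p \<le> Suc z. f p) =
    (if prime (Suc z) then f (Suc z) else 1) * (\<Prod>p | prime p \<and> p < Suc z. f p)"
proof -
  have "{p. prime p \<and> p \<le> Suc z} = (if prime (Suc z) then insert (Suc z) {p. prime p \<and> p < Suc z} else {p. prime p \<and> p < Suc z})"
    by (auto simp: le_less)
  moreover have "finite {p. prime p \<and> p < Suc z}"
    by (rule finite_subset[of _ "{..z}"]) auto
  ultimately show ?thesis by simp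
qed

lemma primes_less_Suc: "{p::nat. prime p \<and> p < Suc z} = {p. prime p \<and> p \<le> z}"
  by auto

lemma sum_primes_Suc:
  fixes f :: "nat \<Rightarrow> 'a::comm_monoid_add"
  shows "(\<Sum>p | prime p \<and> p \<le> Suc z. f p) =
    (if prime (Suc z) then f (Suc z) else 0) + (\<Sum>p | prime p \<and> p \<le> z. f p)"
proof -
  have "{p. prime p \<and> p \<le> Suc z} = (if prime (Suc z) then insert (Suc z) {p. prime p \<and> p \<le> z} else {p. prime p \<and> p \<le> z})"
    by (auto simp: le_Suc_eq)
  then show ?thesis by simp
qed

lemma prod_primes_telescope:
  fixes f :: "nat \<Rightarrow> real"
  shows "(\<Prod>p | prime p \<and> p \<le> z. 1 + f p) - 1 =
    (\<Sum>q | prime q \<and> q \<le> z. f q * (\<Prod>p | prime p \<and> p < q. 1 + f p))"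
proof (induction z)
  case 0
  have "{p::nat. prime p \<and> p \<le> 0} = {}" by auto
  then show ?case by (simp only: prod.empty sum.empty)
next
  case (Suc z)
  then show ?case
    unfolding prod_primes_Suc sum_primes_Suc primes_less_Suc by (simp add: algebra_simps)
qed

text \<open>The bound telescopes because \<open>q / (q - 1)\<^sup>2 \<le> 2 / (q - 1)\<close>.\<close>
lemma sum_corr_weights_le:
  "(\<Sum>q | prime q \<and> q \<le> z. real q / (real q - 1)^2 * (\<Prod>p | prime p \<and> p < q. 1 + 1 / (real p - 1)))
    \<le> 2 * (\<Prod>p | prime p \<and> p \<le> z. 1 + 1 / (real p - 1))"
proof (induction z)
  case 0
  have "{p::nat. prime p \<and> p \<le> 0} = {}" by auto
  then show ?case by (simp only: prod.empty sum.empty)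
next
  case (Suc z)
  let ?T = "\<Prod>p | prime p \<and> p \<le> z. 1 + 1 / (real p - 1)"
  have T: "?T \<ge> 0"
  proof (rule prod_nonneg)
    fix p assume "p \<in> {p. prime p \<and> p \<le> z}"
    then show "0 \<le> 1 + 1 / (real p - 1)" using prime_gt_1_nat[of p] by simp
  qed
  have "real q / (real q - 1)^2 \<le> 2 / (real q - 1)" if "prime q" for q
  proof -
    have q: "real q \<ge> 2" using prime_ge_2_nat[OF that] by simp
    have "real q / (real q - 1)^2 \<le> (2 * (real q - 1)) / (real q - 1)^2"
      using q by (intro divide_right_mono) auto
    also have "\<dots> = 2 / (real q - 1)" using q by (simp add: power2_eq_square del: right_diff_distrib_numeral)
    finally show ?thesis .
  qed
  then have "real q / (real q - 1)^2 * ?T \<le> 2 / (real q - 1) * ?T" if "prime q" for q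
    using that T by (intro mult_right_mono) auto
  moreover have "2 * ((1 + 1 / (real q - 1)) * ?T) = 2 / (real q - 1) * ?T + 2 * ?T" for q
    by (simp add: algebra_simps)
  ultimately show ?case
    using Suc.IH unfolding prod_primes_Suc sum_primes_Suc primes_less_Suc
    by (cases "prime (Suc z)") (simp_all only: if_True if_False add_mono mult_1 add_0)
qed

lemma inverse_Theta_eq: "inverse (\<Theta> (real z)) = (\<Prod>p | prime p \<and> p \<le> z. 1 + 1 / (real p - 1))"
  unfolding Theta_nat prod_inversef[symmetric]
proof (rule prod.cong[OF refl], unfold comp_def)
  fix p assume "p \<in> {p. prime p \<and> p \<le> z}"
  then have "real p \<ge> 2" using prime_ge_2_nat[of p] by simp
  then show "inverse (1 - 1 / real p) = 1 + 1 / (real p - 1)" by (simp add: field_simps)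
qed

lemma cong_prod_primes_iff:
  fixes A :: "nat set"
  assumes "finite A" "\<And>p. p \<in> A \<Longrightarrow> prime p"
  shows "(\<Prod>p\<in>A. of_bool [n = m] (mod p)) = (of_bool [n = m] (mod (\<Prod>p\<in>A. p)) :: real)"
  using assms
proof (induction A)
  case (insert q A)
  have "coprime q (\<Prod>p\<in>A. p)"
  proof (rule prod_coprime_right)
    fix p assume "p \<in> A"
    then have "p \<noteq> q" using insert.hyps by blast
    then show "coprime q p"
      using insert.prems(1) \<open>p \<in> A\<close> by (intro primes_coprime) auto
  qed
  then have "[n = m] (mod q * (\<Prod>p\<in>A. p)) \<longleftrightarrow> [n = m] (mod q) \<and> [n = m] (mod (\<Prod>p\<in>A. p))"
    by (meson coprime_cong_mult_nat cong_modulus_mult_nat mult.commute cong_dvd_modulus_nat dvd_triv_left dvd_triv_right)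
  then show ?case using insert by simp
qed simp

text \<open>For fixed n the sum over m compares the count modulo \<open>e * q\<close> with
  \<open>1 / q\<close> times the count modulo e. The main terms cancel and a bounded error survives,
  independently of e; partial summation inserts the weights in m, while the sum over n is estimated
  trivially.\<close>

lemma sum_corr_increment_le:
  fixes w :: "nat \<Rightarrow> real" and s t e q :: nat
  assumes anti: "\<And>i. s \<le> i \<Longrightarrow> Suc i < t \<Longrightarrow> w (Suc i) \<le> w i"
    and nonneg: "\<And>i. s \<le> i \<Longrightarrow> i < t \<Longrightarrow> 0 \<le> w i"
    and W: "\<And>i. s \<le> i \<Longrightarrow> i < t \<Longrightarrow> w i \<le> W"
    and "e > 0" "q > 0" "coprime e q" "s \<le> t"
  shows "(\<Sum>n\<in>{s..<t}. \<Sum>m\<in>{s..<t}. w n * w m * (of_bool [n = m] (mod e) * (of_bool [n = m] (mod q) - 1 / real q)))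
    \<le> 2 * W^2 * (real t - real s)"
proof (cases "s < t")
  case True
  have W0: "W \<ge> 0" using nonneg[of s] W[of s] True by simp
  have inner: "(\<Sum>m\<in>{s..<t}. w m * (of_bool [n = m] (mod e) * (of_bool [n = m] (mod q) - 1 / real q))) \<le> w s * 2" for n
  proof (rule abel_sum_le[where w = w and s = s and t = t])
    fix k assume k: "s < k" "k \<le> t"
    have "[n = m] (mod e * q) \<longleftrightarrow> [n = m] (mod e) \<and> [n = m] (mod q)" for m
      using assms(6) by (meson coprime_cong_mult_nat cong_modulus_mult_nat mult.commute cong_dvd_modulus_nat dvd_triv_left dvd_triv_right)
    then have "(\<Sum>i\<in>{s..<k}. of_bool [n = i] (mod e) * (of_bool [n = i] (mod q) - 1 / real q)) =
       (\<Sum>i\<in>{s..<k}. of_bool [n = i] (mod e * q) - of_bool [n = i] (mod e) / real q)"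
      by (intro sum.cong) (auto simp: field_simps)
    also have "\<dots> = (\<Sum>i\<in>{s..<k}. of_bool [n = i] (mod e * q)) - (\<Sum>i\<in>{s..<k}. of_bool [n = i] (mod e)) / real q"
      by (simp only: sum_subtractf sum_divide_distrib)
    also have "\<dots> \<le> ((real k - real s) / real (e * q) + 1) - ((real k - real s) / real e - 1) / real q"
      using count_cong_bounds(1)[of "e * q" s k n] count_cong_bounds(2)[of e s k n] k assms(4,5)
      by (intro diff_mono divide_right_mono) auto
    \<comment> \<open>The lengths cancel: rounding costs 1 in the first count and
      \<open>1 / q\<close> in the second.\<close>
    also have "\<dots> = 1 + 1 / real q"
      using assms(4,5) by (simp add: field_simps)
    also have "\<dots> \<le> 2" using assms(5) by simp
    finally show "(\<Sum>i\<in>{s..<k}. of_bool [n = i] (mod e) * (of_bool [n = i] (mod q) - 1 / real q)) \<le> 2" .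
  qed (use anti nonneg True in auto)
  have "(\<Sum>n\<in>{s..<t}. \<Sum>m\<in>{s..<t}. w n * w m * (of_bool [n = m] (mod e) * (of_bool [n = m] (mod q) - 1 / real q)))
     = (\<Sum>n\<in>{s..<t}. w n * (\<Sum>m\<in>{s..<t}. w m * (of_bool [n = m] (mod e) * (of_bool [n = m] (mod q) - 1 / real q))))"
    by (simp only: sum_distrib_left mult.assoc)
  also have "\<dots> \<le> (\<Sum>n\<in>{s..<t}. W * (W * 2))"
  proof (intro sum_mono)
    fix n assume n: "n \<in> {s..<t}"
    have "w n * (\<Sum>m\<in>{s..<t}. w m * (of_bool [n = m] (mod e) * (of_bool [n = m] (mod q) - 1 / real q))) \<le> w n * (W * 2)"
      using nonneg[of n] n inner[of n] W[of s] True by (intro mult_left_mono) auto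
    also have "\<dots> \<le> W * (W * 2)"
      using W[of n] n W0 by (intro mult_right_mono) auto
    finally show "w n * (\<Sum>m\<in>{s..<t}. w m * (of_bool [n = m] (mod e) * (of_bool [n = m] (mod q) - 1 / real q))) \<le> W * (W * 2)" .
  qed
  also have "\<dots> = 2 * W^2 * (real t - real s)"
    using True by (simp add: power2_eq_square)
  finally show ?thesis .
qed (use \<open>s \<le> t\<close> in simp)

text \<open>Expanding the product over the primes below q gives one term for each set A of primes,
  with a nonnegative coefficient and the divisibility condition modulo the product of A, which is
  coprime to q. All terms obey the same bound, so only the sum of the coefficients matters, and it
  is again a product.\<close>

lemma sum_corr_largest_prime_le:
  fixes w :: "nat \<Rightarrow> real" and s t q :: nat
  assumes anti: "\<And>i. s \<le> i \<Longrightarrow> Suc i < t \<Longrightarrow> w (Suc i) \<le> w i"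
    and nonneg: "\<And>i. s \<le> i \<Longrightarrow> i < t \<Longrightarrow> 0 \<le> w i"
    and W: "\<And>i. s \<le> i \<Longrightarrow> i < t \<Longrightarrow> w i \<le> W"
    and "prime q" "s \<le> t"
  shows "(\<Sum>n\<in>{s..<t}. \<Sum>m\<in>{s..<t}. w n * w m * (pair_corr q n m * (\<Prod>p | prime p \<and> p < q. 1 + pair_corr p n m)))
    \<le> real q / (real q - 1)^2 * (\<Prod>p | prime p \<and> p < q. 1 + 1 / (real p - 1)) * (2 * W^2 * (real t - real s))"
proof -
  define P where "P = {p. prime p \<and> p < q}"
  have finP: "finite P" unfolding P_def by (rule finite_subset[of _ "{..q}"]) auto
  have primeP: "prime p" if "p \<in> P" for p using that by (simp add: P_def)
  define \<beta> where "\<beta> p = real p / (real p - 1)^2" for p :: nat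
  define \<alpha> where "\<alpha> p = 1 - 1 / (real p - 1)^2" for p :: nat
  define c where "c A = (\<Prod>p\<in>A. \<beta> p) * (\<Prod>p\<in>P - A. \<alpha> p)" for A
  have \<alpha>: "\<alpha> p \<ge> 0" and \<beta>: "\<beta> p \<ge> 0" and \<alpha>\<beta>: "\<beta> p + \<alpha> p = 1 + 1 / (real p - 1)" if "prime p" for p
  proof -
    have p: "real p \<ge> 2" using prime_ge_2_nat[OF that] by simp
    have "(real p - 1)^2 \<ge> 1^2" using p by (intro power_mono) auto
    then show "\<alpha> p \<ge> 0" by (simp add: \<alpha>_def divide_le_eq)
    show "\<beta> p \<ge> 0" by (simp add: \<beta>_def)
    have "\<beta> p + \<alpha> p = 1 + (real p - 1) / (real p - 1)^2"
      by (simp add: \<alpha>_def \<beta>_def diff_divide_distrib)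
    then show "\<beta> p + \<alpha> p = 1 + 1 / (real p - 1)"
      using p by (simp add: power2_eq_square)
  qed
  have c: "c A \<ge> 0" if "A \<in> Pow P" for A
    unfolding c_def using that primeP \<alpha> \<beta> by (intro mult_nonneg_nonneg prod_nonneg) auto
  have expand: "(\<Prod>p\<in>P. 1 + pair_corr p n m) = (\<Sum>A\<in>Pow P. c A * of_bool [n = m] (mod (\<Prod>p\<in>A. p)))" for n m
  proof -
    have "(\<Prod>p\<in>P. 1 + pair_corr p n m) = (\<Prod>p\<in>P. \<beta> p * of_bool [n = m] (mod p) + \<alpha> p)"
      by (rule prod.cong) (simp_all add: one_plus_pair_corr primeP \<alpha>_def \<beta>_def)
    also have "\<dots> = (\<Sum>A\<in>Pow P. (\<Prod>p\<in>A. \<beta> p * of_bool [n = m] (mod p)) * (\<Prod>p\<in>P - A. \<alpha> p))"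
      using finP by (rule prod_add)
    also have "\<dots> = (\<Sum>A\<in>Pow P. c A * of_bool [n = m] (mod (\<Prod>p\<in>A. p)))"
    proof (rule sum.cong[OF refl])
      fix A assume A: "A \<in> Pow P"
      then have "finite A" using finP finite_subset by blast
      then have "(\<Prod>p\<in>A. of_bool [n = m] (mod p)) = (of_bool [n = m] (mod (\<Prod>p\<in>A. p)) :: real)"
        using A primeP by (intro cong_prod_primes_iff) auto
      then show "(\<Prod>p\<in>A. \<beta> p * of_bool [n = m] (mod p)) * (\<Prod>p\<in>P - A. \<alpha> p) =
          c A * of_bool [n = m] (mod (\<Prod>p\<in>A. p))"
        by (simp only: prod.distrib c_def mult_ac)
    qed
    finally show ?thesis .
  qed
  have pair_corr_q: "pair_corr q n m = \<beta> q * (of_bool [n = m] (mod q) - 1 / real q)" for n m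
    by (simp add: pair_corr_def \<beta>_def)
  define S where "S A = (\<Sum>n\<in>{s..<t}. \<Sum>m\<in>{s..<t}. w n * w m *
    (of_bool [n = m] (mod (\<Prod>p\<in>A. p)) * (of_bool [n = m] (mod q) - 1 / real q)))" for A
  have "(\<Sum>n\<in>{s..<t}. \<Sum>m\<in>{s..<t}. w n * w m * (pair_corr q n m * (\<Prod>p\<in>P. 1 + pair_corr p n m))) =
     (\<Sum>n\<in>{s..<t}. \<Sum>m\<in>{s..<t}. \<Sum>A\<in>Pow P. \<beta> q * c A * (w n * w m *
       (of_bool [n = m] (mod (\<Prod>p\<in>A. p)) * (of_bool [n = m] (mod q) - 1 / real q))))"
    unfolding expand pair_corr_q sum_distrib_left by (simp only: mult_ac)
  also have "\<dots> = (\<Sum>n\<in>{s..<t}. \<Sum>A\<in>Pow P. \<Sum>m\<in>{s..<t}. \<beta> q * c A * (w n * w m *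
       (of_bool [n = m] (mod (\<Prod>p\<in>A. p)) * (of_bool [n = m] (mod q) - 1 / real q))))"
    by (rule sum.cong[OF refl], rule sum.swap)
  also have "\<dots> = (\<Sum>A\<in>Pow P. \<Sum>n\<in>{s..<t}. \<Sum>m\<in>{s..<t}. \<beta> q * c A * (w n * w m *
       (of_bool [n = m] (mod (\<Prod>p\<in>A. p)) * (of_bool [n = m] (mod q) - 1 / real q))))"
    by (rule sum.swap)
  also have "\<dots> = (\<Sum>A\<in>Pow P. \<beta> q * c A * S A)"
    by (simp only: sum_distrib_left S_def)
  also have "\<dots> \<le> (\<Sum>A\<in>Pow P. \<beta> q * c A * (2 * W^2 * (real t - real s)))"
  proof (intro sum_mono mult_left_mono)
    fix A assume A: "A \<in> Pow P"
    have "coprime (\<Prod>p\<in>A. p) q"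
    proof (rule prod_coprime_left)
      fix p assume "p \<in> A"
      then have "prime p" "p \<noteq> q" using A by (auto simp: P_def)
      then show "coprime p q" using assms(4) by (intro primes_coprime)
    qed
    moreover have "(\<Prod>p\<in>A. p) > 0"
      using A primeP by (intro prod_pos) (auto simp: prime_gt_0_nat)
    ultimately show "S A \<le> 2 * W^2 * (real t - real s)"
      unfolding S_def using prime_gt_0_nat[OF assms(4)]
      by (intro sum_corr_increment_le anti nonneg W assms(5))
    show "0 \<le> \<beta> q * c A"
      using c[OF A] \<beta>[OF assms(4)] by simp
  qed
  also have "\<dots> = \<beta> q * (\<Sum>A\<in>Pow P. c A) * (2 * W^2 * (real t - real s))"
    by (simp only: sum_distrib_left sum_distrib_right)
  \<comment> \<open>The same expansion read backwards, with all divisibility indicators set to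
    1.\<close>
  also have "(\<Sum>A\<in>Pow P. c A) = (\<Prod>p\<in>P. \<beta> p + \<alpha> p)"
    unfolding c_def using prod_add[OF finP, of \<beta> \<alpha>] by simp
  also have "\<dots> = (\<Prod>p\<in>P. 1 + 1 / (real p - 1))"
    by (rule prod.cong) (simp_all add: \<alpha>\<beta> primeP)
  finally show ?thesis unfolding P_def \<beta>_def .
qed

lemma upper_interval:
  fixes s t :: nat
  assumes "s \<le> t" and up: "\<And>i j. s \<le> i \<Longrightarrow> i \<le> j \<Longrightarrow> j < t \<Longrightarrow> P i \<Longrightarrow> P j"
  obtains u where "s \<le> u" "u \<le> t" "{n\<in>{s..<t}. P n} = {u..<t}"
proof -
  \<comment> \<open>Admitting \<open>t\<close> as a candidate makes the minimum exist and covers the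
    empty set.\<close>
  define u where "u = (LEAST n. n = t \<or> s \<le> n \<and> n < t \<and> P n)"
  have u: "u = t \<or> s \<le> u \<and> u < t \<and> P u"
    unfolding u_def by (rule LeastI[of _ t]) simp
  have le: "u \<le> n" if "n = t \<or> s \<le> n \<and> n < t \<and> P n" for n
    unfolding u_def using that by (rule Least_le)
  have "{n\<in>{s..<t}. P n} = {u..<t}"
  proof (intro equalityI subsetI)
    fix n assume "n \<in> {n\<in>{s..<t}. P n}"
    then show "n \<in> {u..<t}" using le[of n] by simp
  next
    fix n assume "n \<in> {u..<t}"
    then show "n \<in> {n\<in>{s..<t}. P n}" using u up[of u n] by auto
  qed
  then show ?thesis using that u assms(1) by auto
qed

text \<open>The prime q sieves both n and m only if both lie in \<open>J q\<close>, a final segment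
  because the sieving limit is monotone. Summing over q costs
  \<open>2 / \<Theta>(Z) \<le> 4 * ln s\<close>, the densities contribute
  \<open>2 * (2 / ln s)^2\<close>, and together this gives \<open>32 / ln s\<close> per unit of
  length.\<close>

lemma survival_density_covariance_sum_le:
  fixes s t :: nat
  assumes "8 \<le> s" "s \<le> t" "t \<le> 4 * s"
  shows "(\<Sum>n\<in>{s..<t}. \<Sum>m\<in>{s..<t}. survival_density n * survival_density m *
     ((\<Prod>p | prime p \<and> p \<le> min (sieve_limit (real n)) (sieve_limit (real m)). 1 + pair_corr p n m) - 1))
    \<le> 32 * (real t - real s)"
proof (cases "s < t")
  case True
  define Z where "Z = sieve_limit (real t)"
  define F where "F q n m = pair_corr q n m * (\<Prod>p | prime p \<and> p < q. 1 + pair_corr p n m)" for q n m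
  define J where "J q = {n\<in>{s..<t}. q \<le> sieve_limit (real n)}" for q
  let ?Q = "{q. prime q \<and> q \<le> Z}"
  define W where "W = survival_density s"
  define T where "T q = (\<Prod>p | prime p \<and> p < q. 1 + 1 / (real p - 1))" for q :: nat
  have ln: "2 \<le> ln (real s)" using assms ln_nat_ge_2 by simp
  have le_Z: "sieve_limit (real n) \<le> Z" if "n \<in> {s..<t}" for n
    unfolding Z_def using that assms by (intro sieve_limit_nat_mono) auto
  have "(\<Sum>n\<in>{s..<t}. \<Sum>m\<in>{s..<t}. survival_density n * survival_density m *
     ((\<Prod>p | prime p \<and> p \<le> min (sieve_limit (real n)) (sieve_limit (real m)). 1 + pair_corr p n m) - 1)) =
     (\<Sum>n\<in>{s..<t}. \<Sum>m\<in>{s..<t}. \<Sum>q\<in>?Q. if n \<in> J q \<and> m \<in> J q then survival_density n * survival_density m * F q n m else 0)"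
  proof (intro sum.cong[OF refl])
    fix n m assume nm: "n \<in> {s..<t}" "m \<in> {s..<t}"
    let ?Q' = "{q. prime q \<and> q \<le> min (sieve_limit (real n)) (sieve_limit (real m))}"
    have "?Q \<inter> {q. n \<in> J q \<and> m \<in> J q} = ?Q'"
      using nm le_Z[OF nm(1)] by (auto simp: J_def)
    then have "(\<Sum>q\<in>?Q. if n \<in> J q \<and> m \<in> J q then survival_density n * survival_density m * F q n m else 0) =
       (\<Sum>q\<in>?Q'. survival_density n * survival_density m * F q n m)"
      by (simp add: sum.If_cases)
    then show "survival_density n * survival_density m *
        ((\<Prod>p | prime p \<and> p \<le> min (sieve_limit (real n)) (sieve_limit (real m)). 1 + pair_corr p n m) - 1) =
        (\<Sum>q\<in>?Q. if n \<in> J q \<and> m \<in> J q then survival_density n * survival_density m * F q n m else 0)"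
      unfolding prod_primes_telescope F_def by (simp only: sum_distrib_left)
  qed
  also have "\<dots> = (\<Sum>n\<in>{s..<t}. \<Sum>q\<in>?Q. \<Sum>m\<in>{s..<t}. if n \<in> J q \<and> m \<in> J q then survival_density n * survival_density m * F q n m else 0)"
    by (rule sum.cong[OF refl], rule sum.swap)
  also have "\<dots> = (\<Sum>q\<in>?Q. \<Sum>n\<in>{s..<t}. \<Sum>m\<in>{s..<t}. if n \<in> J q \<and> m \<in> J q then survival_density n * survival_density m * F q n m else 0)"
    by (rule sum.swap)
  also have "\<dots> = (\<Sum>q\<in>?Q. \<Sum>n\<in>J q. \<Sum>m\<in>J q. survival_density n * survival_density m * F q n m)"
  proof (rule sum.cong[OF refl])
    fix q
    have J: "J q \<subseteq> {s..<t}" "{s..<t} \<inter> J q = J q" by (auto simp: J_def)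
    have "(\<Sum>n\<in>{s..<t}. \<Sum>m\<in>{s..<t}. if n \<in> J q \<and> m \<in> J q then survival_density n * survival_density m * F q n m else 0) =
      (\<Sum>n\<in>{s..<t}. if n \<in> J q then (\<Sum>m\<in>J q. survival_density n * survival_density m * F q n m) else 0)"
    proof (rule sum.cong[OF refl])
      fix n
      show "(\<Sum>m\<in>{s..<t}. if n \<in> J q \<and> m \<in> J q then survival_density n * survival_density m * F q n m else 0) =
         (if n \<in> J q then (\<Sum>m\<in>J q. survival_density n * survival_density m * F q n m) else 0)"
        using sum.inter_restrict[of "{s..<t}" "\<lambda>m. survival_density n * survival_density m * F q n m" "J q"] J by simp
    qed
    also have "\<dots> = (\<Sum>n\<in>J q. \<Sum>m\<in>J q. survival_density n * survival_density m * F q n m)"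
      using sum.inter_restrict[of "{s..<t}" "\<lambda>n. \<Sum>m\<in>J q. survival_density n * survival_density m * F q n m" "J q"] J by simp
    finally show "(\<Sum>n\<in>{s..<t}. \<Sum>m\<in>{s..<t}. if n \<in> J q \<and> m \<in> J q then survival_density n * survival_density m * F q n m else 0) =
      (\<Sum>n\<in>J q. \<Sum>m\<in>J q. survival_density n * survival_density m * F q n m)" .
  qed
  also have "\<dots> \<le> (\<Sum>q\<in>?Q. real q / (real q - 1)^2 * T q * (2 * W^2 * (real t - real s)))"
  proof (rule sum_mono)
    fix q assume q: "q \<in> ?Q"
    obtain u where u: "s \<le> u" "u \<le> t" "J q = {u..<t}"
      unfolding J_def
    proof (rule upper_interval[OF assms(2), of "\<lambda>n. q \<le> sieve_limit (real n)"])
      show "q \<le> sieve_limit (real j)" if "s \<le> i" "i \<le> j" "q \<le> sieve_limit (real i)" for i j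
        using that assms(1) sieve_limit_nat_mono[of i j] by simp
    qed
    have "(\<Sum>n\<in>J q. \<Sum>m\<in>J q. survival_density n * survival_density m * F q n m) \<le>
       real q / (real q - 1)^2 * T q * (2 * W^2 * (real t - real u))"
      unfolding u(3) F_def T_def
    proof (rule sum_corr_largest_prime_le)
      show "survival_density i \<le> W" if "u \<le> i" for i
        unfolding W_def using that u assms by (intro survival_density_antimono) auto
    qed (use q u assms survival_density_pos in \<open>auto intro: survival_density_antimono less_imp_le\<close>)
    also have "\<dots> \<le> real q / (real q - 1)^2 * T q * (2 * W^2 * (real t - real s))"
    proof (intro mult_left_mono)
      have "0 \<le> T q" unfolding T_def
      proof (rule prod_nonneg)
        fix p assume "p \<in> {p. prime p \<and> p < q}"
        then show "0 \<le> 1 + 1 / (real p - 1)" using prime_gt_1_nat[of p] by simp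
      qed
      then show "0 \<le> real q / (real q - 1)^2 * T q" by simp
    qed (use u in auto)
    finally show "(\<Sum>n\<in>J q. \<Sum>m\<in>J q. survival_density n * survival_density m * F q n m) \<le>
      real q / (real q - 1)^2 * T q * (2 * W^2 * (real t - real s))" .
  qed
  also have "\<dots> = (\<Sum>q\<in>?Q. real q / (real q - 1)^2 * T q) * (2 * W^2 * (real t - real s))"
    by (simp only: sum_distrib_right)
  also have "\<dots> \<le> (2 * inverse (\<Theta> (real Z))) * (2 * W^2 * (real t - real s))"
    unfolding inverse_Theta_eq T_def using sum_corr_weights_le[of Z] assms
    by (intro mult_right_mono) auto
  also have "\<dots> \<le> (2 * (2 * ln (real s))) * (2 * W^2 * (real t - real s))"
  proof -
    have "inverse (\<Theta> (real Z)) \<le> ln (real t)"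
      unfolding Z_def using ln_nat_ge_2[of t] assms by (intro inverse_Theta_sieve_limit_le) auto
    \<comment> \<open>\<open>t \<le> 4 * s \<le> s * s\<close>: on such a block the logarithms at
      both ends are comparable.\<close>
    also have "\<dots> \<le> ln (real s * real s)"
      using assms by (intro ln_mono) (auto simp flip: of_nat_mult intro: order.trans[OF assms(3)])
    also have "\<dots> = 2 * ln (real s)"
      using assms by (simp add: ln_mult)
    finally show ?thesis using assms by (intro mult_right_mono) auto
  qed
  also have "\<dots> \<le> (2 * (2 * ln (real s))) * (2 * (2 / ln (real s))^2 * (real t - real s))"
    unfolding W_def using survival_density_le[of s] survival_density_pos[of s] assms ln
    by (intro mult_left_mono mult_right_mono power_mono) auto
  also have "\<dots> = 32 / ln (real s) * (real t - real s)"
    using ln by (simp add: power2_eq_square)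
  \<comment> \<open>The logarithm gained here is given up; a bound linear in the length suffices for
    \<open>c > 3/2\<close>.\<close>
  also have "\<dots> \<le> 32 * (real t - real s)"
    using ln assms by (intro mult_right_mono) (auto simp: divide_le_eq)
  finally show ?thesis .
qed (use assms in simp)

section \<open>The variance of the number of survivors\<close>

lemma pair_corr_cong:
  assumes "prime p" "[n = m] (mod p)"
  shows "pair_corr p n m = 1 / (real p - 1)"
proof -
  have p: "real p \<ge> 2" using prime_ge_2_nat[OF assms(1)] by simp
  have "1 - 1 / real p = (real p - 1) / real p" using p by (simp add: diff_divide_distrib)
  then show ?thesis using p assms(2) by (simp add: pair_corr_def power2_eq_square)
qed

lemma pair_corr_not_cong:
  assumes "prime p" "\<not> [n = m] (mod p)"
  shows "pair_corr p n m = - 1 / (real p - 1)^2"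
  using prime_gt_0_nat[OF assms(1)] assms(2) by (simp add: pair_corr_def)

section \<open>The random model: probabilities and second moments\<close>

locale random_residues = prob_space M for M :: "'w measure" +
  fixes a :: "nat \<Rightarrow> 'w \<Rightarrow> int"
  assumes indep: "indep_vars (\<lambda>_. count_space UNIV) a {p. prime p}"
    and unif: "\<And>p. prime p \<Longrightarrow>
      distr M (count_space UNIV) (a p) = measure_pmf (pmf_of_set {0..<int p})"
begin

lemma measurable_residue: "prime p \<Longrightarrow> a p \<in> measurable M (count_space UNIV)"
  using indep unfolding indep_vars_def by auto

lemma prob_residue:
  assumes "prime p"
  shows "prob (a p -` B \<inter> space M) = real (card ({0..<int p} \<inter> B)) / real p"
proof -
  have "prob (a p -` B \<inter> space M) = measure (distr M (count_space UNIV) (a p)) B"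
    using measurable_residue[OF assms] by (subst measure_distr) auto
  also have "\<dots> = measure_pmf.prob (pmf_of_set {0..<int p}) B"
    using unif[OF assms] by simp
  also have "\<dots> = real (card ({0..<int p} \<inter> B)) / real p"
    using prime_gt_0_nat[OF assms] by (subst measure_pmf_of_set) auto
  finally show ?thesis .
qed

lemma prob_residues:
  assumes "finite A" "\<And>p. p \<in> A \<Longrightarrow> prime p"
  shows "prob {\<omega>\<in>space M. \<forall>p\<in>A. a p \<omega> \<in> B p} = (\<Prod>p\<in>A. real (card ({0..<int p} \<inter> B p)) / real p)"
proof (cases "A = {}")
  case True
  then show ?thesis by (simp add: prob_space)
next
  case False
  have "{\<omega>\<in>space M. \<forall>p\<in>A. a p \<omega> \<in> B p} = (\<Inter>p\<in>A. a p -` B p \<inter> space M)"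
    using False by auto
  also have "prob \<dots> = (\<Prod>p\<in>A. prob (a p -` B p \<inter> space M))"
    by (rule indep_varsD[OF indep False assms(1)]) (use assms in auto)
  also have "\<dots> = (\<Prod>p\<in>A. real (card ({0..<int p} \<inter> B p)) / real p)"
    by (rule prod.cong) (simp_all add: prob_residue assms)
  finally show ?thesis .
qed

definition survives :: "nat \<Rightarrow> 'w set" where
  "survives n = {\<omega>\<in>space M. n \<in> random_primes (\<lambda>p. a p \<omega>)}"

lemma random_primes_iff:
  assumes "n \<ge> 8"
  shows "n \<in> random_primes b \<longleftrightarrow>
    (\<forall>p. prime p \<and> p \<le> sieve_limit (real n) \<longrightarrow> \<not> [int n = b p] (mod int p))"
proof -
  have "exp 2 \<le> exp (ln (real n))" using ln_nat_ge_2[OF assms] by simp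
  then have "exp 2 \<le> real n" using assms by simp
  then show ?thesis by (auto simp: random_primes_def sifted_def)
qed

lemma survives_Int:
  assumes "n \<ge> 8" "m \<ge> 8"
  shows "survives n \<inter> survives m = {\<omega>\<in>space M. \<forall>p\<in>{p. prime p \<and> p \<le> max (sieve_limit (real n)) (sieve_limit (real m))}.
    a p \<omega> \<in> {x. (p \<le> sieve_limit (real n) \<longrightarrow> \<not> [int n = x] (mod int p)) \<and> (p \<le> sieve_limit (real m) \<longrightarrow> \<not> [int m = x] (mod int p))}}"
  by (auto simp: survives_def random_primes_iff assms)

lemma sets_survives:
  assumes "n \<ge> 8" shows "survives n \<in> sets M"
proof -
  have "survives n = {\<omega>\<in>space M. \<forall>p\<in>{p. prime p \<and> p \<le> sieve_limit (real n)}. a p \<omega> \<in> {x. \<not> [int n = x] (mod int p)}}"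
    by (auto simp: survives_def random_primes_iff assms)
  also have "\<dots> \<in> sets M"
  proof (rule sets.sets_Collect_finite_All)
    fix p assume "p \<in> {p. prime p \<and> p \<le> sieve_limit (real n)}"
    then have "a p -` {x. \<not> [int n = x] (mod int p)} \<inter> space M \<in> sets M"
      using measurable_residue[of p] by (intro measurable_sets) auto
    then show "{\<omega>\<in>space M. a p \<omega> \<in> {x. \<not> [int n = x] (mod int p)}} \<in> sets M"
      by (simp add: vimage_def Int_def conj_commute)
  qed simp
  finally show ?thesis .
qed

text \<open>\<open>P\<close> and \<open>Q\<close> say whether p sieves n and m respectively. Zero,
  one or two classes are forbidden; the right-hand side separates the two marginal factors from the
  correlation, which appears only if p sieves both.\<close>

lemma card_residues_avoiding:
  fixes p n m :: nat
  assumes "prime p"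
  shows "real (card ({0..<int p} \<inter> {x. (P \<longrightarrow> \<not> [int n = x] (mod int p)) \<and> (Q \<longrightarrow> \<not> [int m = x] (mod int p))})) / real p
    = (if P then 1 - 1 / real p else 1) * (if Q then 1 - 1 / real p else 1) * (if P \<and> Q then 1 + pair_corr p n m else 1)"
proof -
  have p: "real p \<ge> 2" "p > 0" using prime_ge_2_nat[OF assms] by simp_all
  define r where "r = real p - 1"
  have r: "real p = r + 1" "r > 0" using p by (simp_all add: r_def)
  have mem: "int n mod int p \<in> {0..<int p}" for n using p by simp
  have eq: "[int n = x] (mod int p) \<longleftrightarrow> x = int n mod int p" if "x \<in> {0..<int p}" for n x
    using that by (auto simp: cong_def)
  have "{0..<int p} \<inter> {x. (P \<longrightarrow> \<not> [int n = x] (mod int p)) \<and> (Q \<longrightarrow> \<not> [int m = x] (mod int p))}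
      = {0..<int p} - ((if P then {int n mod int p} else {}) \<union> (if Q then {int m mod int p} else {}))" (is "?L = _ - ?S")
    using eq by auto
  moreover have "?S \<subseteq> {0..<int p}" using mem by auto
  ultimately have card: "card ?L = p - card ?S"
    by (simp add: card_Diff_subset finite_subset)
  have "[n = m] (mod p) \<longleftrightarrow> int n mod int p = int m mod int p"
    by (simp add: cong_def flip: of_nat_mod)
  then have "card ?S = (if P \<and> Q then (if [n = m] (mod p) then 1 else 2) else if P \<or> Q then 1 else 0)"
    by auto
  moreover have "1 + pair_corr p n m = (if [n = m] (mod p) then 1 + 1 / r else 1 - 1 / r^2)"
    using pair_corr_cong[OF assms] pair_corr_not_cong[OF assms] by (simp add: r_def)
  moreover have "real (p - 1) = r" "real (p - 2) = r - 1"
    using p r by (simp_all add: of_nat_diff)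
  moreover have red: "1 - 1 / (r + 1) = r / (r + 1)"
    using r by (simp add: field_simps)
  moreover have "r / (r + 1) * (r / (r + 1)) * (1 + 1 / r) = r / (r + 1)"
  proof -
    have "1 + 1 / r = (r + 1) / r" using r by (simp add: field_simps)
    then show ?thesis using r by (simp only:) simp
  qed
  moreover have "r / (r + 1) * (r / (r + 1)) * (1 - 1 / r^2) = (r - 1) / (r + 1)"
  proof -
    have "1 - 1 / r^2 = (r + 1) * (r - 1) / r^2" using r by (simp add: field_simps power2_eq_square)
    then show ?thesis using r by (simp only: power2_eq_square) simp
  qed
  ultimately show ?thesis
    unfolding card using r by (auto simp: numeral_2_eq_2)
qed

lemma prob_survives_Int:
  assumes "n \<ge> 8" "m \<ge> 8"
  shows "prob (survives n \<inter> survives m) = survival_density n * survival_density m *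
    (\<Prod>p | prime p \<and> p \<le> min (sieve_limit (real n)) (sieve_limit (real m)). 1 + pair_corr p n m)"
proof -
  define u v where "u = sieve_limit (real n)" and "v = sieve_limit (real m)"
  let ?A = "{p. prime p \<and> p \<le> max u v}"
  have restrict: "(\<Prod>p\<in>?A. if p \<le> k then f p else 1) = (\<Prod>p | prime p \<and> p \<le> k. f p)"
    if "k \<le> max u v" for k and f :: "nat \<Rightarrow> real"
  proof -
    have "?A \<inter> {p. p \<le> k} = {p. prime p \<and> p \<le> k}" using that by auto
    then show ?thesis by (simp add: prod.If_cases)
  qed
  have "min u v \<le> max u v" by (simp add: min_def)
  note restrict' = restrict[OF this] restrict[OF max.cobounded1] restrict[OF max.cobounded2]
  have "prob (survives n \<inter> survives m) =
      (\<Prod>p\<in>?A. real (card ({0..<int p} \<inter> {x. (p \<le> u \<longrightarrow> \<not> [int n = x] (mod int p)) \<and> (p \<le> v \<longrightarrow> \<not> [int m = x] (mod int p))})) / real p)"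
    unfolding survives_Int[OF assms] u_def[symmetric] v_def[symmetric] by (rule prob_residues) auto
  also have "\<dots> = (\<Prod>p\<in>?A. (if p \<le> u then 1 - 1 / real p else 1) * (if p \<le> v then 1 - 1 / real p else 1) *
      (if p \<le> min u v then 1 + pair_corr p n m else 1))"
    by (intro prod.cong refl) (simp add: card_residues_avoiding)
  also have "\<dots> = \<Theta> (real u) * \<Theta> (real v) * (\<Prod>p | prime p \<and> p \<le> min u v. 1 + pair_corr p n m)"
    unfolding prod.distrib restrict' Theta_nat by (rule refl)
  finally show ?thesis by (simp add: u_def v_def survival_density_def)
qed

text \<open>The diagonal case of the pair formula: each correlation factor equals
  \<open>1 / (1 - 1/p)\<close> and cancels one of the two densities.\<close>

lemma prob_survives:
  assumes "n \<ge> 8" shows "prob (survives n) = survival_density n"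
proof -
  have "(\<Prod>p | prime p \<and> p \<le> sieve_limit (real n). 1 + pair_corr p n n) = inverse (survival_density n)"
    unfolding survival_density_def inverse_Theta_eq
  proof (rule prod.cong[OF refl])
    fix p assume "p \<in> {p. prime p \<and> p \<le> sieve_limit (real n)}"
    then show "1 + pair_corr p n n = 1 + 1 / (real p - 1)"
      by (simp add: pair_corr_cong)
  qed
  then show ?thesis
    using prob_survives_Int[OF assms assms] survival_density_pos[of n] by simp
qed

definition dev :: "nat \<Rightarrow> 'w \<Rightarrow> real" where
  "dev n \<omega> = indicator (survives n) \<omega> - survival_density n"

lemma integrable_dev_mult:
  assumes "n \<ge> 8" "m \<ge> 8" shows "integrable M (\<lambda>\<omega>. dev n \<omega> * dev m \<omega>)"
proof (rule integrable_const_bound[where B = "(1 + survival_density n) * (1 + survival_density m)"])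
  have "\<bar>dev n \<omega>\<bar> \<le> 1 + survival_density n" for n \<omega>
    using survival_density_pos[of n] by (auto simp: dev_def indicator_def)
  then show "AE \<omega> in M. norm (dev n \<omega> * dev m \<omega>) \<le> (1 + survival_density n) * (1 + survival_density m)"
    by (auto simp: abs_mult intro!: mult_mono order.trans[OF abs_ge_zero])
  show "(\<lambda>\<omega>. dev n \<omega> * dev m \<omega>) \<in> borel_measurable M"
    unfolding dev_def using sets_survives[of n] sets_survives[of m] assms by measurable
qed

lemma expectation_dev_mult:
  assumes "n \<ge> 8" "m \<ge> 8"
  shows "expectation (\<lambda>\<omega>. dev n \<omega> * dev m \<omega>) = survival_density n * survival_density m *
    ((\<Prod>p | prime p \<and> p \<le> min (sieve_limit (real n)) (sieve_limit (real m)). 1 + pair_corr p n m) - 1)"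
proof -
  have [measurable]: "survives n \<in> sets M" "survives m \<in> sets M"
    using assms sets_survives by auto
  have "dev n \<omega> * dev m \<omega> = indicator (survives n \<inter> survives m) \<omega> - survival_density m * indicator (survives n) \<omega>
      - survival_density n * indicator (survives m) \<omega> + survival_density n * survival_density m" for \<omega>
    by (auto simp: dev_def indicator_def algebra_simps)
  then have "expectation (\<lambda>\<omega>. dev n \<omega> * dev m \<omega>) = prob (survives n \<inter> survives m) - survival_density m * prob (survives n)
      - survival_density n * prob (survives m) + survival_density n * survival_density m"
    by (simp add: prob_space emeasure_eq_measure)
  then show ?thesis
    unfolding prob_survives_Int[OF assms] using prob_survives assms by (simp add: algebra_simps)
qed

lemma expectation_sum_dev_square_le:
  assumes "8 \<le> s" "s \<le> t" "t \<le> 4 * s"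
  shows "integrable M (\<lambda>\<omega>. (\<Sum>n\<in>{s..<t}. dev n \<omega>)^2)"
    and "expectation (\<lambda>\<omega>. (\<Sum>n\<in>{s..<t}. dev n \<omega>)^2) \<le> 32 * (real t - real s)"
proof -
  have eq: "(\<Sum>n\<in>{s..<t}. dev n \<omega>)^2 = (\<Sum>n\<in>{s..<t}. \<Sum>m\<in>{s..<t}. dev n \<omega> * dev m \<omega>)" for \<omega>
    by (simp add: power2_eq_square sum_product)
  have int: "integrable M (\<lambda>\<omega>. dev n \<omega> * dev m \<omega>)" if "n \<in> {s..<t}" "m \<in> {s..<t}" for n m
    using that assms by (intro integrable_dev_mult) auto
  show "integrable M (\<lambda>\<omega>. (\<Sum>n\<in>{s..<t}. dev n \<omega>)^2)"
    unfolding eq by (intro Bochner_Integration.integrable_sum int)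
  have "expectation (\<lambda>\<omega>. (\<Sum>n\<in>{s..<t}. dev n \<omega>)^2) =
      (\<Sum>n\<in>{s..<t}. \<Sum>m\<in>{s..<t}. expectation (\<lambda>\<omega>. dev n \<omega> * dev m \<omega>))"
    unfolding eq using int
    by (simp only: Bochner_Integration.integral_sum Bochner_Integration.integrable_sum cong: sum.cong)
  also have "\<dots> = (\<Sum>n\<in>{s..<t}. \<Sum>m\<in>{s..<t}. survival_density n * survival_density m *
     ((\<Prod>p | prime p \<and> p \<le> min (sieve_limit (real n)) (sieve_limit (real m)). 1 + pair_corr p n m) - 1))"
    using assms by (intro sum.cong refl expectation_dev_mult) auto
  also have "\<dots> \<le> 32 * (real t - real s)"
    using assms by (rule survival_density_covariance_sum_le)
  finally show "expectation (\<lambda>\<omega>. (\<Sum>n\<in>{s..<t}. dev n \<omega>)^2) \<le> 32 * (real t - real s)" .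
qed

end

section \<open>The maximal inequality\<close>

text \<open>The squares of the sums over all left halves in the binary subdivision of a block of
  length \<open>2 ^ K\<close>. Right halves are left out because a proper initial segment of the
  block is a disjoint union of left halves, at most one per level.\<close>

fun dyadic_energy :: "(nat \<Rightarrow> real) \<Rightarrow> nat \<Rightarrow> nat \<Rightarrow> real" where
  "dyadic_energy y 0 s = 0"
| "dyadic_energy y (Suc K) s =
    dyadic_energy y K s + dyadic_energy y K (s + 2 ^ K) + (\<Sum>i\<in>{s..<s + 2 ^ K}. y i)^2"

lemma dyadic_energy_nonneg: "dyadic_energy y K s \<ge> 0"
  by (induction K arbitrary: s) auto

text \<open>Cauchy--Schwarz with weights 1 and k, in the form that adds one piece to k earlier ones;
  \<open>k = 0\<close> forces \<open>y = 0\<close>.\<close>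

lemma square_add_le:
  fixes x y d k :: real
  assumes "y^2 \<le> k * d" "k \<ge> 0" "d \<ge> 0"
  shows "(x + y)^2 \<le> (k + 1) * (x^2 + d)"
proof (cases "k = 0")
  case False
  have "0 \<le> (k * x - y)^2" by simp
  then have "k * (x + y)^2 \<le> (k + 1) * (k * x^2 + y^2)"
    by (simp add: power2_eq_square algebra_simps)
  also have "\<dots> \<le> (k + 1) * (k * x^2 + k * d)"
    using assms by (intro mult_left_mono) auto
  also have "\<dots> = k * ((k + 1) * (x^2 + d))" by (simp add: algebra_simps)
  finally show ?thesis using False assms(2) by (simp add: mult_le_cancel_left_pos)
qed (use assms in simp)

text \<open>The binary digits of m select the left halves that make up the segment, so at most K
  sums are added. The right-hand side does not depend on m and therefore controls the
  maximum.\<close>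

lemma rademacher_menshov:
  assumes "m < 2 ^ K"
  shows "(\<Sum>i\<in>{s..<s + m}. y i)^2 \<le> real K * dyadic_energy y K s"
  using assms
proof (induction K arbitrary: m s)
  case (Suc K)
  show ?case
  proof (cases "m < 2 ^ K")
    case True
    then have "(\<Sum>i\<in>{s..<s + m}. y i)^2 \<le> real K * dyadic_energy y K s" by (rule Suc.IH)
    also have "\<dots> \<le> real (Suc K) * dyadic_energy y (Suc K) s"
      by (intro mult_mono) (auto simp: dyadic_energy_nonneg)
    finally show ?thesis .
  next
    case False
    define m' where "m' = m - 2 ^ K"
    have m: "m = 2 ^ K + m'" "m' < 2 ^ K" using False Suc.prems by (auto simp: m'_def)
    have "(\<Sum>i\<in>{s..<s + m}. y i) = (\<Sum>i\<in>{s..<s + 2 ^ K}. y i) + (\<Sum>i\<in>{s + 2 ^ K..<s + 2 ^ K + m'}. y i)"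
      unfolding m(1) by (subst sum.atLeastLessThan_concat) (auto simp: add.assoc)
    also have "\<dots>^2 \<le> (real K + 1) * ((\<Sum>i\<in>{s..<s + 2 ^ K}. y i)^2 + dyadic_energy y K (s + 2 ^ K))"
      by (intro square_add_le Suc.IH m(2)) (auto simp: dyadic_energy_nonneg)
    also have "\<dots> \<le> (real K + 1) * dyadic_energy y (Suc K) s"
      by (intro mult_left_mono) (auto simp: dyadic_energy_nonneg)
    finally show ?thesis by (simp add: add.commute)
  qed
qed simp

lemma sum_dyadic_shells_le:
  fixes y :: "nat \<Rightarrow> real"
  assumes shell: "\<And>k m. k \<ge> 3 \<Longrightarrow> m \<le> 2 ^ k \<Longrightarrow>
      \<bar>\<Sum>i\<in>{2 ^ k..<2 ^ k + m}. y i\<bar> \<le> C * (sqrt 2 ^ k * real (k + 1) powr c)"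
    and "C \<ge> 0" "c \<ge> 0" "3 \<le> K" "2 ^ K \<le> n" "n \<le> 2 ^ (K + 1)"
  shows "\<bar>\<Sum>i\<in>{8..<n}. y i\<bar> \<le> 4 * C * (sqrt 2 ^ K * real (K + 1) powr c)"
  using assms(4-6)
proof (induction K arbitrary: n rule: dec_induct)
  case base
  have "\<bar>\<Sum>i\<in>{8..<n}. y i\<bar> \<le> C * (sqrt 2 ^ 3 * real (3 + 1) powr c)"
    using shell[of 3 "n - 8"] base by simp
  also have "\<dots> \<le> 4 * C * (sqrt 2 ^ 3 * real (3 + 1) powr c)"
    using assms(2) by (intro mult_right_mono) auto
  finally show ?case .
next
  case (step K)
  let ?P = "real (Suc K + 1) powr c"
  have "(8::nat) \<le> 2 ^ Suc K"
    using power_increasing[of 3 "Suc K" "2::nat"] step(1) by simp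
  then have "(\<Sum>i\<in>{8..<n}. y i) = (\<Sum>i\<in>{8..<2 ^ Suc K}. y i) + (\<Sum>i\<in>{2 ^ Suc K..<2 ^ Suc K + (n - 2 ^ Suc K)}. y i)"
    using step.prems by (subst sum.atLeastLessThan_concat) auto
  also have "\<bar>\<dots>\<bar> \<le> 4 * C * (sqrt 2 ^ K * real (K + 1) powr c) + C * (sqrt 2 ^ Suc K * ?P)"
    using step.prems step(1) step.IH[of "2 ^ Suc K"] shell[of "Suc K" "n - 2 ^ Suc K"]
    by (intro order.trans[OF abs_triangle_ineq] add_mono) auto
  also have "\<dots> \<le> 4 * C * (sqrt 2 ^ K * ?P) + C * (sqrt 2 ^ Suc K * ?P)"
    using assms(2,3) by (intro add_right_mono mult_left_mono powr_mono2) auto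
  also have "\<dots> = (4 + sqrt 2) * (C * (sqrt 2 ^ K * ?P))"
    by (simp add: algebra_simps)
  also have "\<dots> \<le> (4 * sqrt 2) * (C * (sqrt 2 ^ K * ?P))"
  proof (rule mult_right_mono)
    \<comment> \<open>The constant 4 reproduces itself from shell to shell because
      \<open>4 + sqrt 2 \<le> 4 * sqrt 2\<close>.\<close>
    have "4/3 \<le> sqrt (2::real)" by (rule real_le_rsqrt) (simp add: power2_eq_square)
    then show "4 + sqrt 2 \<le> 4 * sqrt (2::real)" by simp
  qed (use assms(2) in auto)
  also have "\<dots> = 4 * C * (sqrt 2 ^ Suc K * ?P)" by simp
  finally show ?case .
qed

lemma dyadic_shells_bound:
  fixes y :: "nat \<Rightarrow> real"
  assumes shell: "\<And>k m. k \<ge> 3 \<Longrightarrow> m \<le> 2 ^ k \<Longrightarrow>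
      \<bar>\<Sum>i\<in>{2 ^ k..<2 ^ k + m}. y i\<bar> \<le> C * (sqrt 2 ^ k * real (k + 1) powr c)"
    and "C \<ge> 0" "c \<ge> 0" "n \<ge> 8"
  shows "\<bar>\<Sum>i\<in>{8..<n}. y i\<bar> \<le> 4 * C * (sqrt (real n) * (2 * ln (real n)) powr c)"
proof -
  obtain K where K: "2 ^ K \<le> n" "n < 2 ^ (K + 1)"
    using ex_power_ivl1[of 2 n] assms(4) by auto
  have "3 \<le> K"
  proof (rule ccontr)
    assume "\<not> 3 \<le> K"
    then have "(2::nat) ^ (K + 1) \<le> 2 ^ 3" by (intro power_increasing) auto
    then show False using K assms(4) by simp
  qed
  then have "\<bar>\<Sum>i\<in>{8..<n}. y i\<bar> \<le> 4 * C * (sqrt 2 ^ K * real (K + 1) powr c)"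
    using K assms by (intro sum_dyadic_shells_le shell) auto
  also have "\<dots> \<le> 4 * C * (sqrt (real n) * (2 * ln (real n)) powr c)"
  proof (intro mult_left_mono mult_mono powr_mono2)
    have le: "2 ^ K \<le> real n" using K(1) by (metis of_nat_le_iff of_nat_numeral of_nat_power)
    then show "sqrt 2 ^ K \<le> sqrt (real n)" by (simp flip: real_sqrt_power)
    \<comment> \<open>With \<open>ln 2 \<ge> 2/3\<close> this gives
      \<open>K \<le> 3/2 * ln n\<close>, and the additional 1 is at most
      \<open>ln n / 2\<close>.\<close>
    have "real K * ln 2 \<le> ln (real n)"
      using le ln_mono[of "2 ^ K" "real n"] by (simp add: ln_realpow)
    moreover have "real K * (2/3) \<le> real K * ln 2"
      using ln2_ge_two_thirds by (intro mult_left_mono) auto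
    ultimately show "real (K + 1) \<le> 2 * ln (real n)"
      using ln_nat_ge_2[OF assms(4)] by simp
  qed (use assms in auto)
  finally show ?thesis .
qed

context random_residues
begin

text \<open>Each of the K levels adds at most the variance bound for the whole block. The condition
  on \<open>s\<close> passes to both halves and keeps every left half within the range of that
  bound.\<close>

lemma dyadic_energy_dev:
  assumes "8 \<le> s" "2 ^ K \<le> 3 * s"
  shows "integrable M (\<lambda>\<omega>. dyadic_energy (\<lambda>n. dev n \<omega>) K s)" (is ?int)
    and "expectation (\<lambda>\<omega>. dyadic_energy (\<lambda>n. dev n \<omega>) K s) \<le> 32 * real K * 2 ^ K" (is ?le)
proof -
  have "?int \<and> ?le" using assms
  proof (induction K arbitrary: s)
    case (Suc K)
    have 1: "integrable M (\<lambda>\<omega>. dyadic_energy (\<lambda>n. dev n \<omega>) K s)"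
      "expectation (\<lambda>\<omega>. dyadic_energy (\<lambda>n. dev n \<omega>) K s) \<le> 32 * real K * 2 ^ K"
      using Suc by auto
    have 2: "integrable M (\<lambda>\<omega>. dyadic_energy (\<lambda>n. dev n \<omega>) K (s + 2 ^ K))"
      "expectation (\<lambda>\<omega>. dyadic_energy (\<lambda>n. dev n \<omega>) K (s + 2 ^ K)) \<le> 32 * real K * 2 ^ K"
      using Suc.IH[of "s + 2 ^ K"] Suc.prems by auto
    have "s + 2 ^ K \<le> 4 * s" using Suc.prems by simp
    then have 3: "integrable M (\<lambda>\<omega>. (\<Sum>n\<in>{s..<s + 2 ^ K}. dev n \<omega>)^2)"
      "expectation (\<lambda>\<omega>. (\<Sum>n\<in>{s..<s + 2 ^ K}. dev n \<omega>)^2) \<le> 32 * 2 ^ K"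
      using expectation_sum_dev_square_le[of s "s + 2 ^ K"] Suc.prems by auto
    have "expectation (\<lambda>\<omega>. dyadic_energy (\<lambda>n. dev n \<omega>) (Suc K) s) \<le>
        32 * real K * 2 ^ K + 32 * real K * 2 ^ K + 32 * 2 ^ K"
      using 1 2 3 by simp
    also have "\<dots> \<le> 32 * real (Suc K) * 2 ^ Suc K" by (simp add: algebra_simps)
    finally show ?case using 1 2 3 by simp
  qed simp
  then show ?int ?le by auto
qed

text \<open>The normalised energies have summable expectations, so their sum is almost surely finite
  and each of them is below it. No tail estimate for single shells is needed.\<close>

lemma AE_shells_bounded:
  assumes "c > 3 / 2"
  shows "AE \<omega> in M. \<exists>C\<ge>0. \<forall>k\<ge>3. \<forall>m\<le>2 ^ k.
    \<bar>\<Sum>i\<in>{2 ^ k..<2 ^ k + m}. dev i \<omega>\<bar> \<le> C * (sqrt 2 ^ k * real (k + 1) powr c)"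
proof -
  \<comment> \<open>The square of the intended bound, without its constant.\<close>
  define h where "h k = 2 ^ k * real (k + 1) powr (2 * c)" for k :: nat
  define g where "g k \<omega> = real (k + 1) * dyadic_energy (\<lambda>n. dev n \<omega>) (k + 1) (2 ^ k) / h k" for k \<omega>
  have h: "h k > 0" for k by (simp add: h_def)
  have g0: "g k \<omega> \<ge> 0" for k \<omega>
    using h[of k] by (simp add: g_def dyadic_energy_nonneg)
  have eight: "8 \<le> (2::nat) ^ k" if "k \<ge> 3" for k
    using power_increasing[OF that, of "2::nat"] by simp
  have int: "integrable M (g k)"
    and le: "expectation (g k) \<le> 64 * real (k + 1) powr (2 - 2 * c)" if "k \<ge> 3" for k
  proof -
    have e: "integrable M (\<lambda>\<omega>. dyadic_energy (\<lambda>n. dev n \<omega>) (k + 1) (2 ^ k))"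
      "expectation (\<lambda>\<omega>. dyadic_energy (\<lambda>n. dev n \<omega>) (k + 1) (2 ^ k)) \<le> 32 * real (k + 1) * 2 ^ (k + 1)"
      using dyadic_energy_dev[of "2 ^ k" "k + 1"] eight[OF that] by auto
    show "integrable M (g k)" unfolding g_def using e(1) by simp
    have "expectation (g k) = real (k + 1) * expectation (\<lambda>\<omega>. dyadic_energy (\<lambda>n. dev n \<omega>) (k + 1) (2 ^ k)) / h k"
      unfolding g_def by simp
    also have "\<dots> \<le> real (k + 1) * (32 * real (k + 1) * 2 ^ (k + 1)) / h k"
      using e(2) h[of k] by (intro divide_right_mono mult_left_mono) auto
    also have "\<dots> = 64 * (real (k + 1) powr 2 / real (k + 1) powr (2 * c))"
      by (simp add: h_def powr_numeral power2_eq_square)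
    also have "\<dots> = 64 * real (k + 1) powr (2 - 2 * c)"
      by (simp add: powr_diff)
    finally show "expectation (g k) \<le> 64 * real (k + 1) powr (2 - 2 * c)" .
  qed
  \<comment> \<open>One factor k comes from the maximal inequality and one from the number of
    levels; \<open>2 - 2 * c < -1\<close> is exactly \<open>c > 3/2\<close>.\<close>
  have "summable (\<lambda>k. real k powr (2 - 2 * c))"
    using assms by (simp add: summable_real_powr_iff)
  then have "summable (\<lambda>k. real (k + 4) powr (2 - 2 * c))"
    by (subst summable_iff_shift)
  then have summ: "summable (\<lambda>k. 64 * real (k + 3 + 1) powr (2 - 2 * c))"
    by (intro summable_mult) (simp add: add_ac)
  have "(\<integral>\<^sup>+\<omega>. (\<Sum>k. ennreal (g (k + 3) \<omega>)) \<partial>M) = (\<Sum>k. \<integral>\<^sup>+\<omega>. ennreal (g (k + 3) \<omega>) \<partial>M)"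
    using int by (intro nn_integral_suminf) (auto dest: borel_measurable_integrable)
  also have "\<dots> = (\<Sum>k. ennreal (expectation (g (k + 3))))"
    using int g0 by (intro suminf_cong nn_integral_eq_integral) auto
  also have "\<dots> \<le> (\<Sum>k. ennreal (64 * real (k + 3 + 1) powr (2 - 2 * c)))"
    by (intro suminf_le ennreal_leI le) auto
  also have "\<dots> < \<infinity>"
    using summ by (simp add: suminf_ennreal2 less_top)
  finally have fin: "(\<integral>\<^sup>+\<omega>. (\<Sum>k. ennreal (g (k + 3) \<omega>)) \<partial>M) \<noteq> \<infinity>" by simp
  have "AE \<omega> in M. (\<Sum>k. ennreal (g (k + 3) \<omega>)) \<noteq> \<infinity>"
    using fin int by (intro nn_integral_noteq_infinite) (auto dest: borel_measurable_integrable)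
  then show ?thesis
  proof eventually_elim
    case (elim \<omega>)
    define S where "S = enn2real (\<Sum>k. ennreal (g (k + 3) \<omega>))"
    have gS: "g k \<omega> \<le> S" if "k \<ge> 3" for k
    proof -
      have "(\<Sum>j\<in>{k - 3}. ennreal (g (j + 3) \<omega>)) \<le> (\<Sum>k. ennreal (g (k + 3) \<omega>))"
        by (intro sum_le_suminf) auto
      then have "ennreal (g k \<omega>) \<le> (\<Sum>k. ennreal (g (k + 3) \<omega>))"
        using that by simp
      also have "\<dots> = ennreal S"
        unfolding S_def using elim by (simp add: less_top)
      finally show ?thesis by (simp add: S_def)
    qed
    show ?case
    proof (intro exI[of _ "sqrt S"] conjI allI impI)
      show "sqrt S \<ge> 0" by (simp add: S_def)
      fix k m :: nat assume k: "k \<ge> 3" "m \<le> 2 ^ k"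
      have "(\<Sum>i\<in>{2 ^ k..<2 ^ k + m}. dev i \<omega>)^2 \<le> real (k + 1) * dyadic_energy (\<lambda>n. dev n \<omega>) (k + 1) (2 ^ k)"
      proof (rule rademacher_menshov)
        have "m < 2 * 2 ^ k" using k(2) zero_less_power[of "2::nat" k] by linarith
        then show "m < 2 ^ (k + 1)" by simp
      qed
      also have "\<dots> = g k \<omega> * h k" using h[of k] by (simp add: g_def)
      also have "\<dots> \<le> S * h k" using gS[OF k(1)] h[of k] by (intro mult_right_mono) auto
      finally have "\<bar>\<Sum>i\<in>{2 ^ k..<2 ^ k + m}. dev i \<omega>\<bar> \<le> sqrt (S * h k)"
        by (rule real_le_rsqrt[of "\<bar>_\<bar>", unfolded power2_abs])
      also have "\<dots> = sqrt S * (sqrt 2 ^ k * real (k + 1) powr c)"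
      proof -
        have "(real (k + 1) powr c)^2 = real (k + 1) powr (2 * c)"
          by (simp add: power2_eq_square flip: powr_add)
        then have "sqrt (real (k + 1) powr (2 * c)) = real (k + 1) powr c"
          by (metis powr_ge_zero real_sqrt_unique)
        then show ?thesis by (simp add: h_def real_sqrt_mult real_sqrt_power)
      qed
      finally show "\<bar>\<Sum>i\<in>{2 ^ k..<2 ^ k + m}. dev i \<omega>\<bar> \<le> sqrt S * (sqrt 2 ^ k * real (k + 1) powr c)" .
    qed
  qed
qed

lemma AE_sum_dev_bounded:
  assumes "c > 3 / 2"
  shows "AE \<omega> in M. \<exists>C\<ge>0. \<forall>n\<ge>8. \<bar>\<Sum>i\<in>{8..<n}. dev i \<omega>\<bar> \<le> C * (sqrt (real n) * ln (real n) powr c)"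
  using AE_shells_bounded[OF assms]
proof eventually_elim
  case (elim \<omega>)
  then obtain C where C: "C \<ge> 0" "\<And>k m. k \<ge> 3 \<Longrightarrow> m \<le> 2 ^ k \<Longrightarrow>
      \<bar>\<Sum>i\<in>{2 ^ k..<2 ^ k + m}. dev i \<omega>\<bar> \<le> C * (sqrt 2 ^ k * real (k + 1) powr c)"
    by blast
  have "\<bar>\<Sum>i\<in>{8..<n}. dev i \<omega>\<bar> \<le> (4 * C * 2 powr c) * (sqrt (real n) * ln (real n) powr c)" if "n \<ge> 8" for n
  proof -
    have "\<bar>\<Sum>i\<in>{8..<n}. dev i \<omega>\<bar> \<le> 4 * C * (sqrt (real n) * (2 * ln (real n)) powr c)"
      using C that assms by (intro dyadic_shells_bound) auto
    then show ?thesis using that by (simp add: powr_mult mult_ac)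
  qed
  then show ?case using C(1) by (intro exI[of _ "4 * C * 2 powr c"]) auto
qed

end

section \<open>Comparison with the logarithmic integral\<close>

lemma integrable_inverse_ln: "2 \<le> a \<Longrightarrow> (\<lambda>t. 1 / ln t) integrable_on {a..b::real}"
  by (intro integrable_continuous_real continuous_intros) auto

lemma integral_inverse_ln_bounds:
  fixes a b :: real
  assumes "2 \<le> a" "a \<le> b"
  shows "(b - a) / ln b \<le> integral {a..b} (\<lambda>t. 1 / ln t)"
    and "integral {a..b} (\<lambda>t. 1 / ln t) \<le> (b - a) / ln a"
proof -
  have "integral {a..b} (\<lambda>t. 1 / ln b) \<le> integral {a..b} (\<lambda>t. 1 / ln t)"
    using assms by (intro integral_le integrable_inverse_ln) (auto intro!: divide_left_mono mult_pos_pos)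
  then show "(b - a) / ln b \<le> integral {a..b} (\<lambda>t. 1 / ln t)"
    using assms by simp
  have "integral {a..b} (\<lambda>t. 1 / ln t) \<le> integral {a..b} (\<lambda>t. 1 / ln a)"
    using assms by (intro integral_le integrable_inverse_ln) (auto intro!: divide_left_mono mult_pos_pos)
  then show "integral {a..b} (\<lambda>t. 1 / ln t) \<le> (b - a) / ln a"
    using assms by simp
qed

text \<open>As \<open>1 / ln\<close> decreases, each unit interval contributes between 0 and the
  drop of \<open>1 / ln\<close> across it, and the drops telescope.\<close>

lemma sum_inverse_ln_minus_integral:
  assumes "n \<ge> 8"
  shows "0 \<le> (\<Sum>i\<in>{8..<n}. 1 / ln (real i)) - integral {8..real n} (\<lambda>t. 1 / ln t)"
    and "(\<Sum>i\<in>{8..<n}. 1 / ln (real i)) - integral {8..real n} (\<lambda>t. 1 / ln t) \<le> 1 / ln 8 - 1 / ln (real n)"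
proof -
  define D where "D n = (\<Sum>i\<in>{8..<n}. 1 / ln (real i)) - integral {8..real n} (\<lambda>t. 1 / ln t)" for n
  have "0 \<le> D n \<and> D n \<le> 1 / ln 8 - 1 / ln (real n)"
    using assms
  proof (induction n rule: dec_induct)
    case base
    show ?case by (simp add: D_def)
  next
    case (step n)
    have "integral {8..real (Suc n)} (\<lambda>t. 1 / ln t) =
        integral {8..real n} (\<lambda>t. 1 / ln t) + integral {real n..real (Suc n)} (\<lambda>t. 1 / ln t)"
      using step(1) by (intro Henstock_Kurzweil_Integration.integral_combine[symmetric] integrable_inverse_ln) auto
    then have "D (Suc n) = D n + (1 / ln (real n) - integral {real n..real (Suc n)} (\<lambda>t. 1 / ln t))"
      using step(1) by (simp add: D_def)
    moreover have "1 / ln (real (Suc n)) \<le> integral {real n..real (Suc n)} (\<lambda>t. 1 / ln t)"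
      "integral {real n..real (Suc n)} (\<lambda>t. 1 / ln t) \<le> 1 / ln (real n)"
      using integral_inverse_ln_bounds[of "real n" "real (Suc n)"] step(1) by simp_all
    ultimately show ?case using step.IH by linarith
  qed
  then show "0 \<le> (\<Sum>i\<in>{8..<n}. 1 / ln (real i)) - integral {8..real n} (\<lambda>t. 1 / ln t)"
    "(\<Sum>i\<in>{8..<n}. 1 / ln (real i)) - integral {8..real n} (\<lambda>t. 1 / ln t) \<le> 1 / ln 8 - 1 / ln (real n)"
    by (auto simp: D_def)
qed

lemma sum_inverse_ln_approx:
  assumes "x \<ge> 8"
  shows "\<bar>(\<Sum>i\<in>{8..<Suc (nat \<lfloor>x\<rfloor>)}. 1 / ln (real i)) - integral {2..x} (\<lambda>t. 1 / ln t)\<bar>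
    \<le> 2 + integral {2..8} (\<lambda>t. 1 / ln t)"
proof -
  define n where "n = nat \<lfloor>x\<rfloor>"
  have n: "n \<ge> 8" "real n \<le> x" "x \<le> real n + 1"
    using assms by (auto simp: n_def le_nat_iff le_floor_iff)
  have ln: "2 \<le> ln (real n)" using ln_nat_ge_2[OF n(1)] .
  define I where "I a b = integral {a..b} (\<lambda>t. 1 / ln t)" for a b :: real
  have "I 2 x = I 2 8 + I 8 x" "I 8 x = I 8 (real n) + I (real n) x"
    unfolding I_def using n assms
    by (intro Henstock_Kurzweil_Integration.integral_combine[symmetric] integrable_inverse_ln; simp)+
  moreover have "0 \<le> I (real n) x" "I (real n) x \<le> 1"
  proof -
    have "0 \<le> (x - real n) / ln x" using n by simp
    then show "0 \<le> I (real n) x"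
      using integral_inverse_ln_bounds(1)[of "real n" x] n unfolding I_def by linarith
    have "(x - real n) / ln (real n) \<le> 1 / 1" using n ln by (intro frac_le) auto
    then show "I (real n) x \<le> 1"
      using integral_inverse_ln_bounds(2)[of "real n" x] n unfolding I_def by linarith
  qed
  moreover have "0 \<le> I 2 8"
    unfolding I_def by (intro integral_nonneg integrable_inverse_ln) auto
  moreover have "1 / ln (real n) \<le> 1" "0 \<le> 1 / ln (real n)" "1 / ln 8 \<le> (1::real)"
    using ln ln_8_ge by simp_all
  ultimately show ?thesis
    using sum_inverse_ln_minus_integral[OF n(1)] n(1)
    unfolding n_def[symmetric] I_def[symmetric] sum.atLeastLessThan_Suc[OF n(1)] by linarith
qed

lemma sum_inverse_sqrt_le:
  assumes "n \<ge> 8" shows "(\<Sum>i\<in>{8..<n}. 1 / sqrt (real i)) \<le> 3 * sqrt (real n)"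
  using assms
proof (induction n rule: dec_induct)
  case (step n)
  define u v where "u = sqrt (real n)" and "v = sqrt (real (Suc n))"
  have u: "u > 0" using step(1) by (simp add: u_def)
  have "u \<le> v" by (simp add: u_def v_def)
  have "v \<le> sqrt (4 * real n)"
    unfolding v_def using step(1) by (intro real_sqrt_le_mono) simp
  then have "v \<le> 2 * u" by (simp add: u_def real_sqrt_mult)
  have "v^2 - u^2 = 1" by (simp add: u_def v_def)
  then have "1 = (v - u) * (v + u)" by (simp add: power2_eq_square algebra_simps)
  also have "\<dots> \<le> (v - u) * (3 * u)"
    using \<open>u \<le> v\<close> \<open>v \<le> 2 * u\<close> by (intro mult_left_mono) auto
  finally have "1 / u \<le> 3 * (v - u)" using u by (simp add: field_simps)
  then show ?case using step unfolding u_def v_def by simp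
qed simp

text \<open>The differences are nonnegative; finitely many exceptional ones go into the constant,
  the others are at most \<open>1 / sqrt i\<close>.\<close>

lemma sum_density_approx:
  "\<exists>C\<ge>0. \<forall>n\<ge>8. \<bar>(\<Sum>i\<in>{8..<n}. survival_density i) - (\<Sum>i\<in>{8..<n}. 1 / ln (real i))\<bar> \<le> C + 3 * sqrt (real n)"
proof -
  define e where "e i = survival_density i - 1 / ln (real i)" for i
  obtain N where N: "\<And>n. n \<ge> N \<Longrightarrow> e n \<le> 1 / sqrt (real n)"
    using survival_density_approx unfolding eventually_sequentially e_def by blast
  define C where "C = (\<Sum>i\<in>{..<N}. \<bar>e i\<bar>)"
  have "\<bar>(\<Sum>i\<in>{8..<n}. survival_density i) - (\<Sum>i\<in>{8..<n}. 1 / ln (real i))\<bar> \<le> C + 3 * sqrt (real n)"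
    if "n \<ge> 8" for n
  proof -
    have "0 \<le> (\<Sum>i\<in>{8..<n}. e i)"
      by (intro sum_nonneg) (simp add: e_def survival_density_ge)
    moreover have "(\<Sum>i\<in>{8..<n}. e i) \<le> (\<Sum>i\<in>{8..<n}. (if i \<in> {..<N} then \<bar>e i\<bar> else 0) + 1 / sqrt (real i))"
    proof (rule sum_mono)
      fix i
      show "e i \<le> (if i \<in> {..<N} then \<bar>e i\<bar> else 0) + 1 / sqrt (real i)"
        using N[of i] abs_ge_self[of "e i"] by (cases "i < N") (auto intro: add_increasing2)
    qed
    moreover have "(\<Sum>i\<in>{8..<n}. if i \<in> {..<N} then \<bar>e i\<bar> else 0) \<le> C"
      unfolding C_def by (subst sum.inter_restrict[symmetric]) (auto intro: sum_mono2)
    ultimately show ?thesis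
      using sum_inverse_sqrt_le[OF that] by (simp add: sum.distrib e_def sum_subtractf)
  qed
  then show ?thesis
    by (intro exI[of _ C]) (auto simp: C_def intro: sum_nonneg)
qed

context random_residues
begin

lemma card_random_primes_eq:
  assumes "\<omega> \<in> space M" "x \<ge> 8"
  shows "\<bar>real (card {n \<in> random_primes (\<lambda>p. a p \<omega>). real n \<le> x}) -
    ((\<Sum>i\<in>{8..<Suc (nat \<lfloor>x\<rfloor>)}. dev i \<omega>) + (\<Sum>i\<in>{8..<Suc (nat \<lfloor>x\<rfloor>)}. survival_density i))\<bar> \<le> 8"
proof -
  define R where "R = random_primes (\<lambda>p. a p \<omega>)"
  define n where "n = nat \<lfloor>x\<rfloor>"
  have le: "real i \<le> x \<longleftrightarrow> i < Suc n" for i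
    using assms(2) unfolding n_def by (simp add: less_Suc_eq_le le_nat_floor le_nat_iff le_floor_iff)
  have n8: "8 < Suc n" using le[of 8] assms(2) by simp
  have "{i \<in> R. real i \<le> x} = (R \<inter> {..<8}) \<union> (R \<inter> {8..<Suc n})"
    using n8 by (auto simp: le)
  then have "card {i \<in> R. real i \<le> x} = card (R \<inter> {..<8}) + card (R \<inter> {8..<Suc n})"
    by (simp only:) (rule card_Un_disjoint; force)
  moreover have "card (R \<inter> {..<8}) \<le> 8"
    using card_mono[of "{..<8}" "R \<inter> {..<8}"] by simp
  moreover have "real (card (R \<inter> {8..<Suc n})) = (\<Sum>i\<in>{8..<Suc n}. dev i \<omega>) + (\<Sum>i\<in>{8..<Suc n}. survival_density i)"
  proof -
    have "(\<Sum>i\<in>{8..<Suc n}. dev i \<omega>) + (\<Sum>i\<in>{8..<Suc n}. survival_density i) = (\<Sum>i\<in>{8..<Suc n}. indicator R i)"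
      unfolding sum.distrib[symmetric] using assms(1)
      by (intro sum.cong refl) (auto simp: dev_def survives_def R_def indicator_def)
    then show ?thesis by (simp add: indicator_def sum.If_cases Int_commute del: sum.op_ivl_Suc)
  qed
  ultimately show ?thesis unfolding R_def n_def[symmetric] by simp
qed

lemma AE_card_random_primes:
  assumes "c > 3 / 2"
  shows "AE \<omega> in M.
           (\<lambda>x::real. real (card {n \<in> random_primes (\<lambda>p. a p \<omega>). real n \<le> x})
                        - integral {2..x} (\<lambda>t. 1 / ln t))
             \<in> O[at_top](\<lambda>x. x powr (1 / 2) * ln x powr c)"
  using AE_sum_dev_bounded[OF assms] AE_space
proof eventually_elim
  case (elim \<omega>)
  obtain C where C: "C \<ge> 0" "\<And>n. n \<ge> 8 \<Longrightarrow> \<bar>\<Sum>i\<in>{8..<n}. dev i \<omega>\<bar> \<le> C * (sqrt (real n) * ln (real n) powr c)"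
    using elim(1) by blast
  obtain D where D: "D \<ge> 0" "\<And>n. n \<ge> 8 \<Longrightarrow>
      \<bar>(\<Sum>i\<in>{8..<n}. survival_density i) - (\<Sum>i\<in>{8..<n}. 1 / ln (real i))\<bar> \<le> D + 3 * sqrt (real n)"
    using sum_density_approx by blast
  define I where "I = integral {2..8} (\<lambda>t::real. 1 / ln t)"
  have I: "I \<ge> 0" unfolding I_def by (intro integral_nonneg integrable_inverse_ln) auto
  \<comment> \<open>Here \<open>10 = 8 + 2\<close> collects the integers below 8 and the comparison
    of sum and integral; 6 is three times the 2 of \<open>sqrt n \<le> 2 * sqrt x\<close>, and
    \<open>2 * 2 powr c\<close> pays for passing from n to x in the random part.\<close>
  define K where "K = 10 + I + D + 6 + C * (2 * 2 powr c)"
  show ?case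
  proof (rule bigoI[of _ K])
    show "eventually (\<lambda>x::real. norm (real (card {n \<in> random_primes (\<lambda>p. a p \<omega>). real n \<le> x})
        - integral {2..x} (\<lambda>t. 1 / ln t)) \<le> K * norm (x powr (1 / 2) * ln x powr c)) at_top"
      using eventually_ge_at_top[of 8]
    proof eventually_elim
      case (elim x)
      define n where "n = Suc (nat \<lfloor>x\<rfloor>)"
      have n: "8 \<le> n" "real n \<le> x + 1"
        using elim by (simp_all add: n_def le_nat_iff le_floor_iff le_SucI)
      have "8 * x \<le> x * x" using elim by (intro mult_right_mono) auto
      then have x: "x + 1 \<le> x * x" "x + 1 \<le> 4 * x" using elim by linarith+
      have "ln 8 \<le> ln x" using elim by (intro ln_mono) auto
      then have lnx: "2 \<le> ln x" using ln_8_ge by linarith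
      have sq: "sqrt (real n) \<le> 2 * sqrt x"
      proof -
        have "sqrt (real n) \<le> sqrt (4 * x)" using n x by (intro real_sqrt_le_mono) simp
        then show ?thesis by (simp add: real_sqrt_mult)
      qed
      have "ln (real n) \<le> ln (x * x)" using n x elim by (intro ln_mono) auto
      then have "ln (real n) \<le> 2 * ln x" using elim by (simp add: ln_mult)
      then have "ln (real n) powr c \<le> (2 * ln x) powr c"
        using assms ln_nat_ge_2[OF n(1)] by (intro powr_mono2) auto
      then have lnc: "ln (real n) powr c \<le> 2 powr c * ln x powr c"
        using lnx by (simp add: powr_mult)
      define B where "B = sqrt x * ln x powr c"
      have "1 \<le> ln x powr c" using lnx assms by (intro ge_one_powr_ge_zero) auto
      moreover have "1 \<le> sqrt x" using elim by simp
      ultimately have B: "1 \<le> B" "sqrt x \<le> B"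
        unfolding B_def using mult_mono[of 1 "sqrt x" 1 "ln x powr c"] mult_left_mono[of 1 "ln x powr c" "sqrt x"] elim by auto
      have "sqrt (real n) * ln (real n) powr c \<le> (2 * sqrt x) * (2 powr c * ln x powr c)"
        using sq lnc elim by (intro mult_mono) auto
      then have "C * (sqrt (real n) * ln (real n) powr c) \<le> C * ((2 * 2 powr c) * B)"
        using C(1) by (intro mult_left_mono) (auto simp: B_def mult_ac)
      then have "\<bar>real (card {n \<in> random_primes (\<lambda>p. a p \<omega>). real n \<le> x}) - integral {2..x} (\<lambda>t. 1 / ln t)\<bar> \<le>
          8 + C * ((2 * 2 powr c) * B) + (D + 3 * sqrt (real n)) + (2 + I)"
        using card_random_primes_eq[OF \<open>\<omega> \<in> space M\<close> elim] C(2)[OF n(1)] D(2)[OF n(1)]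
          sum_inverse_ln_approx[OF elim]
        unfolding n_def[symmetric] I_def[symmetric] by linarith
      also have "\<dots> \<le> (10 + I + D) * B + 6 * B + C * ((2 * 2 powr c) * B)"
      proof -
        have "8 + V + (D + 3 * sqrt (real n)) + (2 + I) \<le> U + 6 * B + V" if "10 + I + D \<le> U" for U V
          using that sq B(2) by linarith
        moreover have "10 + I + D \<le> (10 + I + D) * B"
          using mult_left_mono[OF B(1), of "10 + I + D"] I D(1) by simp
        ultimately show ?thesis by blast
      qed
      also have "\<dots> = K * B" by (simp add: K_def algebra_simps)
      also have "\<dots> = K * norm (x powr (1 / 2) * ln x powr c)"
        using elim by (simp add: B_def powr_half_sqrt)
      finally show ?case by simp
    qed
  qed
qed

end

theorem theorem1p4:
  fixes M :: "'w measure" and a :: "nat \<Rightarrow> 'w \<Rightarrow> int" and c :: real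
  assumes "prob_space M"
    and "prob_space.indep_vars M (\<lambda>_. count_space UNIV) a {p. prime p}"
    and "\<And>p. prime p \<Longrightarrow>
           distr M (count_space UNIV) (a p) = measure_pmf (pmf_of_set {0..<int p})"
    and "c > 3 / 2"
  shows "AE \<omega> in M.
           (\<lambda>x::real. real (card {n \<in> random_primes (\<lambda>p. a p \<omega>). real n \<le> x})
                        - integral {2..x} (\<lambda>t. 1 / ln t))
             \<in> O[at_top](\<lambda>x. x powr (1 / 2) * ln x powr c)"
proof -
  interpret random_residues M a
    using assms by (intro random_residues.intro random_residues_axioms.intro)
  show ?thesis using assms(4) by (rule AE_card_random_primes)
qed

end
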